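(* Let $n \geq 2$ and let $K, L$ be convex bodies in $\mathbb{R}^n$. Then $d(K, L) < n^2 - 2^{-22} n^{-7}$.
   Context: A convex body in $\mathbb{R}^n$ is a compact convex set with non-empty interior. The Banach-Mazur distance of convex bodies $K, L \subset \mathbb{R}^n$ is $d(K,L) = \inf\{ r > 0 : K+u \subset T(L+v) \subset r(K+u)\}$, the infimum being over all invertible linear operators $T:\mathbb{R}^n\to\mathbb{R}^n$ and all $u,v\in\mathbb{R}^n$. Throughout the paper $n \geq 2$ is an integer. *)

theory Defs
  imports "HOL-Analysis.Analysis"
begin

definition convex_body :: "(real ^ 'n) set \<Rightarrow> bool" where
  "convex_body K \<longleftrightarrow> compact K \<and> convex K \<and> interior K \<noteq> {}"

text \<open>For convex bodies the set below is nonempty and bounded below by 0,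
  so the infimum in the reals is the intended one.\<close>

definition banach_mazur_dist :: "(real ^ 'n) set \<Rightarrow> (real ^ 'n) set \<Rightarrow> real" where
  "banach_mazur_dist K L =
     Inf {r. r > 0 \<and> (\<exists>T u v. linear T \<and> bij T \<and>
       (\<lambda>x. x + u) ` K \<subseteq> T ` ((\<lambda>x. x + v) ` L) \<and>
       T ` ((\<lambda>x. x + v) ` L) \<subseteq> (\<lambda>x. r *\<^sub>R x) ` ((\<lambda>x. x + u) ` K))}"

end

theory Submission imports Defs begin

text \<open>
  Both bodies are compared with the Euclidean unit ball \<open>B\<close>. Place \<open>K\<close> by an affine map so that
  \<open>B \<subseteq> K \<subseteq> r B\<close> with \<open>r\<close> as small as possible. First-order optimality
  (\<open>contact_moments\<close>) says that the normals \<open>u\<close> at which \<open>K\<close> touches \<open>B\<close> and the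
  directions \<open>z\<close> at which \<open>K\<close> touches \<open>r B\<close> carry probability weights with the same
  second moment matrix \<open>G\<close> and with first moments \<open>w\<close> and \<open>r w\<close>. For every such pair
  \<open>s = z \<bullet> u\<close> lies in \<open>[-1, 1 / r]\<close>, so \<open>(1 + s) (1 - r s) \<ge> 0\<close>; averaging over both
  families gives \<open>r |G|\<^sup>2 + r (r - 1) |w|\<^sup>2 \<le> 1\<close>, and \<open>|G|\<^sup>2 \<ge> 1 / n\<close> because \<open>G\<close> has
  trace one. Hence \<open>r \<le> n\<close> (\<open>ratio_le_dim\<close>).

  If \<open>r\<close> is at least \<open>n - \<sigma>\<^sup>2\<close> with \<open>\<sigma> = 2\<^sup>-\<^sup>1\<^sup>1 n\<^sup>-\<^sup>4\<close>, all these estimates are nearly tight: \<open>G\<close>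
  is close to \<open>I / n\<close>, \<open>w\<close> is close to \<open>0\<close>, and the average of \<open>(1 + s) (1 - r s)\<close> is
  at most \<open>2 n \<sigma>\<close> even when one of the two vectors is held fixed, so that \<open>s\<close> is usually close to
  \<open>-1\<close> or to \<open>1 / r\<close>. Therefore every \<open>z\<close> has an almost antipodal \<open>u\<close>
  (\<open>antipodal_inner_contact\<close>), and \<open>n + 1\<close> such pairs can be chosen one after the other so
  that \<open>s\<close> is close to \<open>1 / r\<close> for vectors from different pairs
  (\<open>outer_contact_far_from\<close>). The points \<open>r z\<close> span a simplex inside \<open>K\<close>, the half-spaces
  \<open>u \<bullet> x \<le> 1\<close> cut out a slightly larger one around \<open>K\<close>, and \<open>K\<close> is within distance
  \<open>5 / 4\<close> of a simplex (\<open>bm_le_simplex\<close>).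

  Composition now finishes the proof. If the optimal ratio of one of the two bodies is below
  \<open>n - \<sigma>\<^sup>2\<close>, then going through the ball gives a distance below \<open>n (n - \<sigma>\<^sup>2)\<close>, which is the
  claimed bound. Otherwise both bodies are close to a simplex and the distance is at most
  \<open>25 / 16\<close>.
\<close>

section \<open>Distance bounds that compose\<close>

text \<open>Here the translations in the two inclusions are independent, which makes the relation
  symmetric and multiplicative under composition. In the definition of the distance both
  inclusions share one translation of each body; \<open>banach_mazur_dist_le\<close> reconciles the two.\<close>

definition bm_le :: "(real ^ 'n) set \<Rightarrow> (real ^ 'n) set \<Rightarrow> real \<Rightarrow> bool" where
  "bm_le K L r \<longleftrightarrow> r > 0 \<and> (\<exists>T a b. linear T \<and> bij T \<and>
     (\<forall>x\<in>K. \<exists>y\<in>L. x = a + T y) \<and> (\<forall>y\<in>L. \<exists>x\<in>K. T y = b + r *\<^sub>R x))"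

lemma bm_leI:
  fixes K L :: "(real ^ 'n) set"
  assumes "r > 0" "linear T" "bij T"
    "\<And>x. x \<in> K \<Longrightarrow> \<exists>y\<in>L. x = a + T y" "\<And>y. y \<in> L \<Longrightarrow> \<exists>x\<in>K. T y = b + r *\<^sub>R x"
  shows "bm_le K L r"
  unfolding bm_le_def
  by (intro conjI exI[of _ T] exI[of _ a] exI[of _ b] ballI assms)

lemma bm_le_trans:
  fixes K L M :: "(real ^ 'n) set"
  assumes "bm_le K L r" "bm_le L M s"
  shows "bm_le K M (r * s)"
proof -
  obtain T a b where T: "linear T" "bij T" "\<forall>x\<in>K. \<exists>y\<in>L. x = a + T y"
      "\<forall>y\<in>L. \<exists>x\<in>K. T y = b + r *\<^sub>R x" and r: "r > 0"
    using assms(1) unfolding bm_le_def by blast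
  obtain T' a' b' where T': "linear T'" "bij T'" "\<forall>x\<in>L. \<exists>y\<in>M. x = a' + T' y"
      "\<forall>y\<in>M. \<exists>x\<in>L. T' y = b' + s *\<^sub>R x" and s: "s > 0"
    using assms(2) unfolding bm_le_def by blast
  show ?thesis
  proof (rule bm_leI[where T = "T \<circ> T'" and a = "a + T a'" and b = "T b' + s *\<^sub>R b"])
    show "linear (T \<circ> T')" using T(1) T'(1) by (rule linear_compose[rotated])
    show "bij (T \<circ> T')" using T(2) T'(2) by (rule bij_comp[rotated])
    show "\<exists>y\<in>M. x = a + T a' + (T \<circ> T') y" if x: "x \<in> K" for x
    proof -
      obtain y where y: "y \<in> L" "x = a + T y" using T(3) x by blast
      obtain z where z: "z \<in> M" "y = a' + T' z" using T'(3) y(1) by blast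
      show ?thesis using y z T(1) by (auto simp: linear_add)
    qed
    show "\<exists>x\<in>K. (T \<circ> T') y = T b' + s *\<^sub>R b + (r * s) *\<^sub>R x" if y: "y \<in> M" for y
    proof -
      obtain z where z: "z \<in> L" "T' y = b' + s *\<^sub>R z" using T'(4) y by blast
      obtain x where x: "x \<in> K" "T z = b + r *\<^sub>R x" using T(4) z(1) by blast
      have "(T \<circ> T') y = T b' + s *\<^sub>R T z"
        using z T(1) by (simp add: linear_add linear_scale)
      then show ?thesis using x by (auto simp: scaleR_add_right mult.commute)
    qed
  qed (use r s in simp)
qed

lemma bm_le_sym:
  fixes K L :: "(real ^ 'n) set"
  assumes "bm_le K L r"
  shows "bm_le L K r"
proof -
  obtain T a b where T: "linear T" "bij T" "\<forall>x\<in>K. \<exists>y\<in>L. x = a + T y"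
      "\<forall>y\<in>L. \<exists>x\<in>K. T y = b + r *\<^sub>R x" and r: "r > 0"
    using assms(1) unfolding bm_le_def by blast
  obtain S where S: "linear S" "S \<circ> T = id"
    using linear_injective_left_inverse[OF T(1) bij_is_inj[OF T(2)]] by blast
  have S': "S (T x) = x" for x using S(2) by (simp add: fun_eq_iff)
  have ST: "S (T x) = x" "T (S x) = x" for x
    using S' bij_is_surj[OF T(2)] by (auto, metis surjD)
  show ?thesis
  proof (rule bm_leI[where T = "\<lambda>x. r *\<^sub>R S x" and a = "S b" and b = "r *\<^sub>R S a"])
    show "linear (\<lambda>x. r *\<^sub>R S x)" using S(1) by (rule linear_compose_scale_right)
    show "bij (\<lambda>x. r *\<^sub>R S x)"
    proof (rule bijI)
      show "inj (\<lambda>x. r *\<^sub>R S x)"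
      proof (rule injI)
        fix x y assume "r *\<^sub>R S x = r *\<^sub>R S y"
        then have "T (S x) = T (S y)" using r by simp
        then show "x = y" by (simp only: ST(2))
      qed
      have "r *\<^sub>R S (T ((1 / r) *\<^sub>R x)) = x" for x
        unfolding ST(1) using r by simp
      then show "surj (\<lambda>x. r *\<^sub>R S x)" by (rule surjI)
    qed
    show "\<exists>y\<in>K. x = S b + r *\<^sub>R S y" if x: "x \<in> L" for x
    proof -
      obtain y where y: "y \<in> K" "T x = b + r *\<^sub>R y" using bspec[OF T(4) x] by (elim bexE)
      have "x = S (b + r *\<^sub>R y)" using y(2) ST(1)[of x] by (simp only:)
      also have "\<dots> = S b + r *\<^sub>R S y" by (simp only: linear_add[OF S(1)] linear_scale[OF S(1)])
      finally show ?thesis using y(1) by (rule bexI)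
    qed
    show "\<exists>x\<in>L. r *\<^sub>R S y = r *\<^sub>R S a + r *\<^sub>R x" if y: "y \<in> K" for y
    proof -
      obtain x where x: "x \<in> L" "y = a + T x" using bspec[OF T(3) y] by (elim bexE)
      have "S y = S a + x" unfolding x(2) linear_add[OF S(1)] ST(1) by (rule refl)
      have "r *\<^sub>R S y = r *\<^sub>R S a + r *\<^sub>R x"
        unfolding \<open>S y = S a + x\<close> by (rule scaleR_add_right)
      then show ?thesis using x(1) by (rule bexI)
    qed
  qed (rule r)
qed

text \<open>Shrinking a convex body towards one of its points keeps it inside itself; the centre of the
  shrinking is absorbed by the free translation.\<close>

lemma bm_le_mono:
  fixes K L :: "(real ^ 'n) set"
  assumes "bm_le K L r" "r \<le> r'" "convex K" "K \<noteq> {}"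
  shows "bm_le K L r'"
proof -
  obtain T a b where T: "linear T" "bij T" "\<forall>x\<in>K. \<exists>y\<in>L. x = a + T y"
      "\<forall>y\<in>L. \<exists>x\<in>K. T y = b + r *\<^sub>R x" and r: "r > 0"
    using assms(1) unfolding bm_le_def by blast
  obtain k where k: "k \<in> K" using assms(4) by blast
  show ?thesis
  proof (rule bm_leI[OF _ T(1,2), where a = a and b = "b - (r' - r) *\<^sub>R k"])
    show "\<exists>x\<in>K. T y = b - (r' - r) *\<^sub>R k + r' *\<^sub>R x" if y: "y \<in> L" for y
    proof -
      obtain x where x: "x \<in> K" "T y = b + r *\<^sub>R x" using T(4) y by blast
      have "(r / r') *\<^sub>R x + ((r' - r) / r') *\<^sub>R k \<in> K"
        using assms(2,3) r x(1) k by (intro convexD) (auto simp: field_simps)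
      moreover have "T y = b - (r' - r) *\<^sub>R k + r' *\<^sub>R ((r / r') *\<^sub>R x + ((r' - r) / r') *\<^sub>R k)"
        using x(2) r assms(2) by (simp add: scaleR_add_right)
      ultimately show ?thesis by blast
    qed
  qed (use r assms(2) T(3) in auto)
qed

text \<open>With \<open>K \<subseteq> a + T L\<close> and \<open>T L \<subseteq> b + r K\<close>, the common translations \<open>u\<close>, \<open>v\<close> must satisfy
  \<open>T v = a + u\<close> and \<open>r u = b + T v\<close>. This is solvable because \<open>r > 1\<close>, and it forces
  \<open>u = (a + b) / (r - 1)\<close>.\<close>

lemma banach_mazur_dist_le:
  fixes K L :: "(real ^ 'n) set"
  assumes "bm_le K L r" "r > 1"
  shows "banach_mazur_dist K L \<le> r"
proof -
  obtain T a b where T: "linear T" "bij T" "\<forall>x\<in>K. \<exists>y\<in>L. x = a + T y"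
      "\<forall>y\<in>L. \<exists>x\<in>K. T y = b + r *\<^sub>R x"
    using assms(1) unfolding bm_le_def by blast
  define u where "u = (1 / (r - 1)) *\<^sub>R (a + b)"
  obtain v where v: "T v = a + u" using bij_is_surj[OF T(2)] by (metis surjD)
  have u: "r *\<^sub>R u = b + T v"
  proof -
    have "(r - 1) *\<^sub>R u = a + b" using assms(2) by (simp add: u_def)
    then show ?thesis unfolding v by (simp add: scaleR_diff_left algebra_simps)
  qed
  have 1: "(\<lambda>x. x + u) ` K \<subseteq> T ` ((\<lambda>x. x + v) ` L)"
  proof safe
    fix x assume "x \<in> K"
    then obtain y where y: "y \<in> L" "x = a + T y" using T(3) by blast
    then have "x + u = T (y + v)" using T(1) v by (simp add: linear_add)
    then show "x + u \<in> T ` (\<lambda>x. x + v) ` L" using y(1) by blast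
  qed
  have 2: "T ` ((\<lambda>x. x + v) ` L) \<subseteq> (\<lambda>x. r *\<^sub>R x) ` ((\<lambda>x. x + u) ` K)"
  proof safe
    fix y assume "y \<in> L"
    then obtain x where x: "x \<in> K" "T y = b + r *\<^sub>R x" using T(4) by blast
    then have "T (y + v) = r *\<^sub>R (x + u)" using T(1) u by (simp add: linear_add scaleR_add_right)
    then show "T (y + v) \<in> (*\<^sub>R) r ` (\<lambda>x. x + u) ` K" using x(1) by blast
  qed
  show ?thesis unfolding banach_mazur_dist_def
    by (rule cInf_lower) (use 1 2 T(1,2) assms(2) in \<open>auto intro!: bdd_belowI[where m = 0] less_imp_le\<close>)
qed

section \<open>Smallest sandwich between concentric ellipsoids\<close>

text \<open>Ellipsoids are written as images of the unit ball under a matrix that may be singular, so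
  that the condition stays closed under limits.\<close>

definition ellipsoid_sandwich :: "(real ^ 'n) set \<Rightarrow> real ^ 'n ^ 'n \<Rightarrow> real ^ 'n \<Rightarrow> real \<Rightarrow> bool" where
  "ellipsoid_sandwich K A c r \<longleftrightarrow>
     (\<forall>x\<in>cball 0 1. c + A *v x \<in> K) \<and> (\<forall>y\<in>K. \<exists>x\<in>cball 0 1. y = c + r *\<^sub>R (A *v x))"

text \<open>Each inclusion is a closed condition on \<open>(r, A, c)\<close>; for the outer one this needs the
  compactness of the ball, over which the witness is projected away. Boundedness of \<open>A\<close> comes
  from the inner inclusion, since the columns of \<open>A\<close> are differences of points of \<open>K\<close>.\<close>

lemma compact_ellipsoid_sandwiches:
  fixes K :: "(real ^ 'n) set"
  assumes "compact K"
  shows "compact {(r, A, c). 0 \<le> r \<and> r \<le> R \<and> ellipsoid_sandwich K A c r}"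
    (is "compact ?F")
proof -
  have clK: "closed K" using assms by (rule compact_imp_closed)
  have "?F = {p. 0 \<le> fst p} \<inter> {p. fst p \<le> R}
      \<inter> (\<Inter>x\<in>cball 0 1. {p. snd (snd p) + fst (snd p) *v x \<in> K})
      \<inter> (\<Inter>y\<in>K. {p. \<exists>x. x \<in> cball 0 1 \<and>
            (x, p) \<in> {q. y = snd (snd (snd q)) + fst (snd q) *\<^sub>R (fst (snd (snd q)) *v fst q)}})"
    by (auto simp: ellipsoid_sandwich_def Bex_def simp del: mem_cball mem_cball_0)
  also have "closed \<dots>"
  proof (intro closed_Int closed_INT ballI)
    show "closed {p :: real \<times> (real^'n^'n) \<times> (real^'n). 0 \<le> fst p}"
      by (intro closed_Collect_le continuous_intros)
    show "closed {p :: real \<times> (real^'n^'n) \<times> (real^'n). fst p \<le> R}"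
      by (intro closed_Collect_le continuous_intros)
    show "closed {p :: real \<times> (real^'n^'n) \<times> (real^'n). snd (snd p) + fst (snd p) *v x \<in> K}" for x
    proof -
      have "continuous_on UNIV
          (\<lambda>p :: real \<times> (real^'n^'n) \<times> (real^'n). snd (snd p) + fst (snd p) *v x)"
        unfolding matrix_vector_mult_def by (intro continuous_intros)
      from closed_vimage[OF clK this] show ?thesis by (simp add: vimage_def)
    qed
    show "closed {p :: real \<times> (real^'n^'n) \<times> (real^'n). \<exists>x. x \<in> cball 0 1 \<and>
            (x, p) \<in> {q. y = snd (snd (snd q)) + fst (snd q) *\<^sub>R (fst (snd (snd q)) *v fst q)}}" for y
      unfolding matrix_vector_mult_def
      by (intro closed_compact_projection compact_cball closed_Collect_eq continuous_intros)
  qed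
  finally have cl: "closed ?F" .
  obtain B where B: "\<And>x. x \<in> K \<Longrightarrow> norm x \<le> B"
    using compact_imp_bounded[OF assms] by (auto simp: bounded_iff)
  define N where "N = real CARD('n) * (real CARD('n) * (2 * B))"
  have bA: "norm A \<le> N" and bc: "norm c \<le> B"
    if s: "ellipsoid_sandwich K A c r" for A c r
  proof -
    have inK: "c + A *v x \<in> K" if "norm x \<le> 1" for x
      using s that by (simp add: ellipsoid_sandwich_def)
    show c: "norm c \<le> B" using B[OF inK[of 0]] by simp
    have comp: "\<bar>A $ i $ j\<bar> \<le> 2 * B" for i j
    proof -
      have "norm (c + A *v axis j 1) \<le> B" by (intro B inK) simp
      then have "norm (A *v axis j 1) \<le> 2 * B"
        using c norm_triangle_ineq2[of "c + A *v axis j 1" c] norm_triangle_ineq4[of "c + A *v axis j 1" c]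
        by simp
      moreover have "\<bar>(A *v axis j 1) $ i\<bar> \<le> norm (A *v axis j 1)" by (rule component_le_norm_cart)
      moreover have "(A *v axis j 1) $ i = A $ i $ j"
        by (simp add: matrix_vector_mul_component inner_axis)
      ultimately show ?thesis by simp
    qed
    have row: "norm (A $ i) \<le> real CARD('n) * (2 * B)" for i
    proof -
      have "norm (A $ i) \<le> (\<Sum>j\<in>UNIV. \<bar>A $ i $ j\<bar>)" by (rule norm_le_l1_cart)
      also have "\<dots> \<le> (\<Sum>j\<in>(UNIV::'n set). 2 * B)" by (intro sum_mono comp)
      finally show ?thesis by simp
    qed
    have "norm A \<le> (\<Sum>i\<in>UNIV. norm (A $ i))"
      unfolding norm_vec_def[of A] by (rule L2_set_le_sum) simp
    also have "\<dots> \<le> (\<Sum>i\<in>(UNIV::'n set). real CARD('n) * (2 * B))" by (intro sum_mono row)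
    finally show "norm A \<le> N" by (simp add: N_def)
  qed
  have "?F \<subseteq> {0..R} \<times> cball 0 N \<times> cball 0 B" using bA bc by auto
  moreover have "bounded ({0..R} \<times> cball (0::real^'n^'n) N \<times> cball (0::real^'n) B)"
    by (intro bounded_Times bounded_closed_interval bounded_cball)
  ultimately have "bounded ?F" by (rule bounded_subset[rotated])
  with cl show ?thesis using compact_eq_bounded_closed by blast
qed

lemma ellipsoid_sandwich_exists:
  fixes K :: "(real ^ 'n) set"
  assumes "convex_body K"
  obtains A c r where "r \<ge> 0" "ellipsoid_sandwich K A c r"
proof -
  obtain c e where e: "e > 0" "cball c e \<subseteq> K"
    using assms by (auto simp: convex_body_def mem_interior_cball)
  have "bounded K" using assms by (auto simp: convex_body_def compact_imp_bounded)
  then obtain B0 where B0: "\<forall>x\<in>K. dist c x \<le> B0"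
    unfolding bounded_any_center[of _ c] by blast
  define B where "B = max 0 B0 + 1"
  have B: "B > 0" "\<And>x. x \<in> K \<Longrightarrow> dist c x < B"
    using B0 by (auto simp: B_def)
  have m: "mat e *v x = e *\<^sub>R x" for x :: "real^'n"
    by (simp add: vec_eq_iff mat_def matrix_vector_mult_def if_distrib[of "\<lambda>t. t * _"] cong: if_cong)
  have "ellipsoid_sandwich K (mat e) c (B / e)"
    unfolding ellipsoid_sandwich_def
  proof (intro conjI ballI)
    fix x :: "real^'n" assume x: "x \<in> cball 0 1"
    have "c + mat e *v x \<in> cball c e" using x e(1) by (simp add: m dist_norm)
    then show "c + mat e *v x \<in> K" using e(2) by blast
  next
    fix y assume y: "y \<in> K"
    have "(1 / B) *\<^sub>R (y - c) \<in> cball 0 1"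
      using B(1) B(2)[OF y] by (simp add: dist_norm norm_minus_commute del: scaleR_right_diff_distrib scaleR_diff_right)
    moreover have "y = c + (B / e) *\<^sub>R (mat e *v ((1 / B) *\<^sub>R (y - c)))"
      using B(1) e(1) by (simp add: m)
    ultimately show "\<exists>x\<in>cball 0 1. y = c + (B / e) *\<^sub>R (mat e *v x)" by blast
  qed
  then show ?thesis using that B(1) e(1) by (meson divide_nonneg_pos less_imp_le)
qed

lemma minimal_ellipsoid_sandwich:
  fixes K :: "(real ^ 'n) set"
  assumes "convex_body K"
  obtains A c r where "r \<ge> 0" "ellipsoid_sandwich K A c r"
    "\<And>A' c' r'. r' \<ge> 0 \<Longrightarrow> ellipsoid_sandwich K A' c' r' \<Longrightarrow> r \<le> r'"
proof -
  obtain A0 c0 R where R: "R \<ge> 0" "ellipsoid_sandwich K A0 c0 R"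
    using ellipsoid_sandwich_exists[OF assms] by metis
  let ?F = "{(r, A, c). 0 \<le> r \<and> r \<le> R \<and> ellipsoid_sandwich K A c r}"
  have "compact ?F" using assms by (intro compact_ellipsoid_sandwiches) (simp add: convex_body_def)
  moreover have "?F \<noteq> {}" using R by auto
  ultimately have "\<exists>p\<in>?F. \<forall>q\<in>?F. fst p \<le> fst q"
    by (intro continuous_attains_inf continuous_intros)
  then obtain r A c where m: "0 \<le> r" "r \<le> R" "ellipsoid_sandwich K A c r"
    and min: "\<And>r' A' c'. 0 \<le> r' \<Longrightarrow> r' \<le> R \<Longrightarrow> ellipsoid_sandwich K A' c' r' \<Longrightarrow> r \<le> r'"
    by fastforce
  show ?thesis
  proof (rule that[OF m(1,3)])
    fix A' c' r' assume "r' \<ge> 0" "ellipsoid_sandwich K A' c' r'"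
    then show "r \<le> r'" using min[of r' A' c'] m(2) by (cases "r' \<le> R") auto
  qed
qed

section \<open>Optimal position with respect to the ball\<close>

text \<open>Requiring the two balls to be concentric can only increase \<open>r\<close>, but the common centre is
  what couples the first moments of the two families of contact points in
  \<open>contact_moments\<close> and thereby makes them small.\<close>

locale optimal_ball_position =
  fixes K :: "(real ^ 'n) set" and r :: real
  assumes compact_K: "compact K" and convex_K: "convex K"
    and ball_in_K: "cball 0 1 \<subseteq> K" and K_in_ball: "K \<subseteq> cball 0 r"
    and optimal: "\<And>A c s. 0 \<le> s \<Longrightarrow> ellipsoid_sandwich K A c s \<Longrightarrow> r \<le> s"

text \<open>The minimal ellipsoid is turned into the unit ball. It is non-degenerate because \<open>K\<close> has
  interior points and lies in a translate of the range of its matrix.\<close>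

lemma optimal_ball_position_exists:
  fixes K :: "(real ^ 'n) set"
  assumes "convex_body K"
  obtains L r where "optimal_ball_position L r" "bm_le K L 1"
proof -
  obtain A c r where r0: "r \<ge> 0" and sw: "ellipsoid_sandwich K A c r"
    and min: "\<And>A' c' r'. r' \<ge> 0 \<Longrightarrow> ellipsoid_sandwich K A' c' r' \<Longrightarrow> r \<le> r'"
    using minimal_ellipsoid_sandwich[OF assms] by metis
  have inner: "c + A *v x \<in> K" if "norm x \<le> 1" for x
    using sw that by (simp add: ellipsoid_sandwich_def)
  have outer: "\<exists>x\<in>cball 0 1. y = c + r *\<^sub>R (A *v x)" if "y \<in> K" for y
    using sw that by (simp add: ellipsoid_sandwich_def)
  have "surj ((*v) A)"
  proof -
    obtain y0 e where e: "e > 0" "cball y0 e \<subseteq> K"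
      using assms by (auto simp: convex_body_def mem_interior_cball)
    have "y0 \<in> K" using e by auto
    then obtain x0 where x0: "y0 = c + r *\<^sub>R (A *v x0)" using outer by blast
    have "\<exists>x. v = A *v x" for v
    proof (cases "v = 0")
      case False
      have "y0 + (e / norm v) *\<^sub>R v \<in> K"
        using e False by (intro subsetD[OF e(2)]) (simp add: dist_norm)
      then obtain x where x: "y0 + (e / norm v) *\<^sub>R v = c + r *\<^sub>R (A *v x)" using outer by blast
      then have "(e / norm v) *\<^sub>R v = r *\<^sub>R (A *v (x - x0))"
        unfolding x0 by (simp add: matrix_vector_mult_diff_distrib scaleR_diff_right algebra_simps)
      then have "(norm v / e) *\<^sub>R ((e / norm v) *\<^sub>R v) = A *v ((norm v / e * r) *\<^sub>R (x - x0))"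
        by (simp add: matrix_vector_mult_scaleR)
      then show ?thesis using False e(1) by auto
    qed (auto intro: exI[of _ 0])
    then show ?thesis by (auto simp: surj_def)
  qed
  then obtain B where "A ** B = mat 1"
    using matrix_right_invertible_surjective by blast
  then have AB: "A ** B = mat 1" "B ** A = mat 1"
    using matrix_left_right_inverse by blast+
  have BA: "B *v (A *v x) = x" "A *v (B *v x) = x" for x
    using AB by (simp_all add: matrix_vector_mul_assoc)
  define L where "L = (\<lambda>y. B *v (y - c)) ` K"
  have memL: "x \<in> L \<longleftrightarrow> c + A *v x \<in> K" for x
    unfolding L_def using BA by (auto simp: image_iff) (metis BA(1) add_diff_cancel_left')
  have "optimal_ball_position L r"
  proof
    show "compact L" unfolding L_def matrix_vector_mult_def using assms
      by (intro compact_continuous_image continuous_intros) (auto simp: convex_body_def)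
    have "convex ((*v) B ` ((\<lambda>y. y - c) ` K))" using assms
      by (intro convex_linear_image convex_translation_subtract) (auto simp: convex_body_def)
    then show "convex L" by (simp add: L_def image_image)
    show "cball 0 1 \<subseteq> L" using inner by (auto simp: memL)
    show "L \<subseteq> cball 0 r"
    proof
      fix x assume "x \<in> L"
      then obtain z where z: "z \<in> cball 0 1" "c + A *v x = c + r *\<^sub>R (A *v z)"
        using outer memL by blast
      then have "B *v (A *v x) = B *v (r *\<^sub>R (A *v z))" by simp
      then have "x = r *\<^sub>R z" by (simp add: BA matrix_vector_mult_scaleR)
      then show "x \<in> cball 0 r" using z(1) r0 by (simp add: mult_left_le)
    qed
    show "r \<le> s" if s: "0 \<le> s" and sL: "ellipsoid_sandwich L A' c' s" for A' c' s
    proof (rule min[OF s])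
      show "ellipsoid_sandwich K (A ** A') (c + A *v c') s"
        unfolding ellipsoid_sandwich_def
      proof (intro conjI ballI)
        fix x :: "real^'n" assume "x \<in> cball 0 1"
        then have "c' + A' *v x \<in> L" using sL by (simp add: ellipsoid_sandwich_def)
        then show "c + A *v c' + (A ** A') *v x \<in> K"
          by (simp add: memL matrix_vector_right_distrib matrix_vector_mul_assoc add.assoc)
      next
        fix y assume "y \<in> K"
        then have "B *v (y - c) \<in> L" by (auto simp: L_def)
        then obtain x where x: "x \<in> cball 0 1" "B *v (y - c) = c' + s *\<^sub>R (A' *v x)"
          using sL unfolding ellipsoid_sandwich_def by blast
        then have "A *v (B *v (y - c)) = A *v (c' + s *\<^sub>R (A' *v x))" by simp
        then have "y - c = A *v c' + s *\<^sub>R ((A ** A') *v x)"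
          unfolding BA by (simp add: matrix_vector_right_distrib matrix_vector_mult_scaleR
              matrix_vector_mul_assoc)
        then have "y = c + A *v c' + s *\<^sub>R ((A ** A') *v x)"
          by (simp add: algebra_simps)
        then show "\<exists>x\<in>cball 0 1. y = c + A *v c' + s *\<^sub>R ((A ** A') *v x)" using x(1) by blast
      qed
    qed
  qed
  moreover have "bm_le K L 1"
  proof (rule bm_leI[where T = "(*v) A" and a = c and b = "- c"])
    show "bij ((*v) A)" using BA by (intro o_bij[of "(*v) B"]) (auto simp: fun_eq_iff)
    show "\<exists>y\<in>L. x = c + A *v y" if "x \<in> K" for x
      using that BA by (intro bexI[of _ "B *v (x - c)"]) (auto simp: L_def)
    show "\<exists>x\<in>K. A *v y = - c + 1 *\<^sub>R x" if "y \<in> L" for y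
      using that by (intro bexI[of _ "c + A *v y"]) (auto simp: memL)
  qed auto
  ultimately show ?thesis by (rule that)
qed

lemma (in optimal_ball_position) r_ge_1: "1 \<le> r"
proof -
  obtain v :: "real^'n" where "norm v = 1" using vector_choose_size[of 1] by auto
  then have "v \<in> cball 0 1" by simp
  then have "v \<in> cball 0 r" using ball_in_K K_in_ball by blast
  then show ?thesis using \<open>norm v = 1\<close> by simp
qed

lemma (in optimal_ball_position) bm_le_ball: "bm_le K (cball 0 1) r"
proof (rule bm_leI[where T = "\<lambda>x. r *\<^sub>R x" and a = 0 and b = 0])
  show "bij (\<lambda>x :: real^'n. r *\<^sub>R x)"
    using r_ge_1 by (intro o_bij[of "\<lambda>x. (1 / r) *\<^sub>R x"]) (auto simp: fun_eq_iff)
  show "\<exists>y\<in>cball 0 1. x = 0 + r *\<^sub>R y" if "x \<in> K" for x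
    using that K_in_ball r_ge_1 by (intro bexI[of _ "(1 / r) *\<^sub>R x"]) (auto simp: field_simps)
  show "\<exists>x\<in>K. r *\<^sub>R y = 0 + r *\<^sub>R x" if "y \<in> cball 0 1" for y
    using that ball_in_K by auto
qed (use r_ge_1 in \<open>auto simp: linear_scale_self\<close>)

section \<open>First-order optimality and moments of contact points\<close>

text \<open>The matrix \<open>u u\<^sup>T\<close>. Pairing it with \<open>M\<close> in the Euclidean space of matrices evaluates the
  quadratic form of \<open>M\<close> at \<open>u\<close>, so quadratic expressions in contact points become linear
  functionals.\<close>

definition outer_sq :: "real ^ 'n \<Rightarrow> real ^ 'n ^ 'n" where
  "outer_sq u = (\<chi> i j. u $ i * u $ j)"

lemma inner_outer_sq: "M \<bullet> outer_sq u = u \<bullet> (M *v u)"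
  unfolding outer_sq_def inner_vec_def matrix_vector_mult_def
  by (simp add: sum_distrib_left mult_ac)

lemma outer_sq_inner_outer_sq: "outer_sq u \<bullet> outer_sq v = (u \<bullet> v)\<^sup>2"
  unfolding outer_sq_def inner_vec_def power2_eq_square
  by (simp add: sum_product mult_ac)

lemma continuous_on_outer_sq: "continuous_on S outer_sq"
  unfolding outer_sq_def by (intro continuous_intros)

lemma mat_plus_scaleR_mult_vec: "(mat 1 + t *\<^sub>R M) *v x = x + t *\<^sub>R (M *v x)"
  for M :: "real ^ 'n ^ 'n"
  by (simp add: matrix_vector_mult_add_rdistrib scaleR_matrix_vector_assoc)

context optimal_ball_position
begin

definition inner_contacts :: "(real ^ 'n) set" where
  "inner_contacts = {u. norm u = 1 \<and> (\<forall>x\<in>K. u \<bullet> x \<le> 1)}"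

definition outer_contacts :: "(real ^ 'n) set" where
  "outer_contacts = {z. norm z = 1 \<and> r *\<^sub>R z \<in> K}"

lemma compact_inner_contacts: "compact inner_contacts"
proof -
  have "inner_contacts = sphere 0 1 \<inter> (\<Inter>x\<in>K. {u. u \<bullet> x \<le> 1})"
    by (auto simp: inner_contacts_def)
  moreover have "closed (\<Inter>x\<in>K. {u. u \<bullet> x \<le> 1})"
    by (intro closed_INT ballI closed_Collect_le continuous_intros)
  ultimately show ?thesis by (simp add: compact_Int_closed)
qed

lemma compact_outer_contacts: "compact outer_contacts"
proof -
  have "outer_contacts = sphere 0 1 \<inter> ((*\<^sub>R) r -` K)"
    by (auto simp: outer_contacts_def)
  moreover have "closed ((*\<^sub>R) r -` K)"
    by (intro closed_vimage compact_imp_closed compact_K continuous_intros)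
  ultimately show ?thesis by (simp add: compact_Int_closed)
qed

text \<open>If the perturbed ball leaves \<open>K\<close> for arbitrarily small \<open>t\<close>, then unit vectors separating an
  escaping point from \<open>K\<close> accumulate at an inner contact normal, and the first-order change of
  the ball in that direction is non-negative in the limit.\<close>

lemma inner_perturbation:
  assumes neg: "\<And>u. u \<in> inner_contacts \<Longrightarrow> M \<bullet> outer_sq u + c \<bullet> u < 0"
  shows "\<exists>d>0. \<forall>t. 0 < t \<and> t < d \<longrightarrow> (\<forall>x\<in>cball 0 1. t *\<^sub>R c + (mat 1 + t *\<^sub>R M) *v x \<in> K)"
proof (rule ccontr)
  assume contr: "\<not> ?thesis"
  have "\<exists>t v x. 0 < t \<and> t < 1 / real (Suc k) \<and> (v, x) \<in> sphere 0 1 \<times> cball 0 1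
      \<and> (\<forall>y\<in>K. v \<bullet> y \<le> v \<bullet> x + t * (v \<bullet> (M *v x + c)))" for k
  proof -
    obtain t x where t: "0 < t" "t < 1 / real (Suc k)" and x: "x \<in> cball 0 1"
      and out: "t *\<^sub>R c + (mat 1 + t *\<^sub>R M) *v x \<notin> K"
      using contr by (metis of_nat_0_less_iff zero_less_Suc zero_less_divide_1_iff)
    define p where "p = t *\<^sub>R c + (mat 1 + t *\<^sub>R M) *v x"
    obtain a b where ab: "a \<bullet> p < b" "\<forall>y\<in>K. a \<bullet> y > b"
      using separating_hyperplane_closed_point[OF convex_K compact_imp_closed[OF compact_K], of p] out
      by (auto simp: p_def)
    have "0 \<in> K" using ball_in_K by auto
    then have a0: "a \<noteq> 0" using ab by fastforce
    define v where "v = - (1 / norm a) *\<^sub>R a"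
    have "norm v = 1" using a0 by (simp add: v_def)
    moreover have "v \<bullet> y \<le> v \<bullet> p" if "y \<in> K" for y
    proof -
      have "a \<bullet> p \<le> a \<bullet> y" using ab that by fastforce
      then show ?thesis using a0 by (simp add: v_def divide_right_mono)
    qed
    moreover have "v \<bullet> p = v \<bullet> x + t * (v \<bullet> (M *v x + c))"
      unfolding p_def mat_plus_scaleR_mult_vec
      by (simp only: inner_add_right inner_scaleR_right) (simp add: algebra_simps)
    ultimately show ?thesis using t x by (intro exI[of _ t] exI[of _ v] exI[of _ x]) auto
  qed
  then obtain t v x where t: "\<And>k. 0 < t k" "\<And>k. t k < 1 / real (Suc k)"
    and vx: "\<And>k. (v k, x k) \<in> sphere 0 1 \<times> cball 0 1"
    and sup: "\<And>k y. y \<in> K \<Longrightarrow> v k \<bullet> y \<le> v k \<bullet> x k + t k * (v k \<bullet> (M *v x k + c))"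
    by metis
  have "compact (sphere (0::real^'n) 1 \<times> cball (0::real^'n) 1)"
    by (intro compact_Times compact_sphere compact_cball)
  then obtain l s where l: "l \<in> sphere 0 1 \<times> cball 0 1" and s: "strict_mono s"
    and lim: "((\<lambda>k. (v k, x k)) \<circ> s) \<longlonglongrightarrow> l"
    using vx unfolding compact_def by meson
  define v0 x0 where "v0 = fst l" and "x0 = snd l"
  have vlim: "(\<lambda>k. v (s k)) \<longlonglongrightarrow> v0" and xlim: "(\<lambda>k. x (s k)) \<longlonglongrightarrow> x0"
    using tendsto_fst[OF lim] tendsto_snd[OF lim] by (simp_all add: v0_def x0_def o_def)
  have "t \<longlonglongrightarrow> 0"
    by (rule tendsto_sandwich[OF _ _ tendsto_const LIMSEQ_inverse_real_of_nat])
       (use t in \<open>auto intro!: always_eventually less_imp_le simp: inverse_eq_divide\<close>)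
  then have tlim: "(\<lambda>k. t (s k)) \<longlonglongrightarrow> 0"
    using s by (simp add: LIMSEQ_subseq_LIMSEQ[unfolded o_def])
  have Mlim: "(\<lambda>k. v (s k) \<bullet> (M *v x (s k) + c)) \<longlonglongrightarrow> v0 \<bullet> (M *v x0 + c)"
    using vlim xlim unfolding matrix_vector_mult_def by (intro tendsto_intros)
  have Rlim: "(\<lambda>k. v (s k) \<bullet> x (s k) + t (s k) * (v (s k) \<bullet> (M *v x (s k) + c)))
      \<longlonglongrightarrow> v0 \<bullet> x0 + 0 * (v0 \<bullet> (M *v x0 + c))"
    by (intro tendsto_intros vlim xlim tlim Mlim)
  have sup0: "v0 \<bullet> y \<le> v0 \<bullet> x0" if "y \<in> K" for y
    using LIMSEQ_le[OF tendsto_inner[OF vlim tendsto_const[of y]] Rlim] sup[OF that] by auto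
  have nv: "norm v0 = 1" "norm x0 \<le> 1" using l by (auto simp: v0_def x0_def)
  have "v0 \<in> K" using nv ball_in_K by auto
  then have "1 \<le> v0 \<bullet> x0" using sup0 nv by (metis norm_eq_1)
  moreover have "(norm (x0 - v0))\<^sup>2 = (norm x0)\<^sup>2 - 2 * (v0 \<bullet> x0) + (norm v0)\<^sup>2"
    by (simp add: power2_norm_eq_inner inner_diff inner_commute)
  moreover have "(norm x0)\<^sup>2 \<le> 1" using nv by (simp add: power_le_one)
  ultimately have "(norm (x0 - v0))\<^sup>2 \<le> 0" using nv by simp
  then have x0: "x0 = v0" by simp
  then have "v0 \<in> inner_contacts"
    using sup0 nv by (auto simp: inner_contacts_def norm_eq_1)
  then have "v0 \<bullet> (M *v v0 + c) < 0"
    using neg by (simp add: inner_outer_sq inner_add_right inner_commute[of c])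
  moreover have "0 \<le> v0 \<bullet> (M *v x0 + c)"
  proof (rule LIMSEQ_le_const[OF Mlim], intro exI allI impI)
    fix k
    have "v (s k) \<in> K" using vx[of "s k"] ball_in_K by auto
    then have "1 \<le> v (s k) \<bullet> x (s k) + t (s k) * (v (s k) \<bullet> (M *v x (s k) + c))"
      using sup[of "v (s k)" "s k"] vx[of "s k"] by (simp add: norm_eq_1)
    moreover have "v (s k) \<bullet> x (s k) \<le> norm (v (s k)) * norm (x (s k))" by (rule norm_cauchy_schwarz)
    moreover have "norm (v (s k)) * norm (x (s k)) \<le> 1" using vx[of "s k"] by simp
    ultimately have "0 \<le> t (s k) * (v (s k) \<bullet> (M *v x (s k) + c))" by linarith
    then show "0 \<le> v (s k) \<bullet> (M *v x (s k) + c)" using t(1)[of "s k"] by (simp add: zero_le_mult_iff)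
  qed
  ultimately show False using x0 by simp
qed

text \<open>The analogous statement for the outer ball, whose radius is even reduced by \<open>t\<^sup>2\<close>: a reduction
  of second order does not affect the first-order argument, but it turns the perturbation into a
  strict improvement.\<close>

lemma outer_perturbation:
  assumes pos: "\<And>z. z \<in> outer_contacts \<Longrightarrow> M \<bullet> outer_sq z + (1 / r) * (c \<bullet> z) > 0"
  shows "\<exists>d>0. \<forall>t. 0 < t \<and> t < d \<longrightarrow>
    (\<forall>y\<in>K. \<exists>x\<in>cball 0 1. y = t *\<^sub>R c + (r - t\<^sup>2) *\<^sub>R ((mat 1 + t *\<^sub>R M) *v x))"
proof (rule ccontr)
  assume contr: "\<not> ?thesis"
  obtain B where B: "B > 0" "\<And>x. norm (M *v x) \<le> norm x * B"
    using bounded_linear.pos_bounded[OF matrix_vector_mul_bounded_linear[of M]] by blast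
  define d where "d = min (1 / 2) (1 / (2 * B))"
  have d: "0 < d" "d \<le> 1 / 2" "d * B \<le> 1 / 2" using B(1) by (auto simp: d_def min_def field_simps)
  \<comment> \<open>For \<open>t < d\<close> the matrix \<open>I + t M\<close> is invertible, so a point of \<open>K\<close> outside the perturbed
    ball is the image of some \<open>w\<close> that is too long.\<close>
  have "\<exists>t w. 0 < t \<and> t < 1 / real (Suc k) \<and> t \<le> 1 \<and> w \<in> cball 0 (2 * (r + norm c))
      \<and> r - t\<^sup>2 < norm w \<and> w + t *\<^sub>R (M *v w + c) \<in> K" for k
  proof -
    have "0 < d / real (Suc k)" using d(1) by simp
    then obtain t y where t: "0 < t" "t < d / real (Suc k)" and y: "y \<in> K"
      and out: "\<And>x. x \<in> cball 0 1 \<Longrightarrow> y \<noteq> t *\<^sub>R c + (r - t\<^sup>2) *\<^sub>R ((mat 1 + t *\<^sub>R M) *v x)"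
      using contr by blast
    have "d / real (Suc k) \<le> d / 1" using d(1) by (intro divide_left_mono) auto
    then have td: "t < d" using t by simp
    have "t * B \<le> d * B" using td B(1) by (intro mult_right_mono) auto
    then have tB: "t * B \<le> 1 / 2" using d(3) by linarith
    have contraction: "norm (t *\<^sub>R (M *v x)) \<le> norm x / 2" for x
    proof -
      have "norm (t *\<^sub>R (M *v x)) \<le> t * (norm x * B)" using B(2)[of x] t(1) by (simp add: mult_left_mono)
      also have "\<dots> \<le> norm x * (1 / 2)" using mult_left_mono[OF tB norm_ge_zero[of x]] by (simp add: mult_ac)
      finally show ?thesis by simp
    qed
    have "inj ((*v) (mat 1 + t *\<^sub>R M))"
    proof (subst linear_injective_0[OF matrix_vector_mul_linear], intro allI impI)
      fix x assume "(mat 1 + t *\<^sub>R M) *v x = 0"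
      then have "norm x = norm (t *\<^sub>R (M *v x))"
        unfolding mat_plus_scaleR_mult_vec by (metis add_eq_0_iff2 norm_minus_cancel)
      then have "norm x \<le> norm x / 2" using contraction[of x] by simp
      then show "x = 0" by (simp add: field_simps)
    qed
    then have "surj ((*v) (mat 1 + t *\<^sub>R M))"
      by (rule linear_injective_imp_surjective[OF matrix_vector_mul_linear]) simp
    then obtain w where w: "y - t *\<^sub>R c = (mat 1 + t *\<^sub>R M) *v w" by (meson surjD)
    have yw: "y = w + t *\<^sub>R (M *v w + c)"
      using w unfolding mat_plus_scaleR_mult_vec by (simp add: algebra_simps)
    have "t\<^sup>2 \<le> 1 / 4" using t(1) td d(2) power_mono[of t "1/2" 2] by (simp add: power2_eq_square)
    then have rt: "r - t\<^sup>2 > 0" using r_ge_1 by linarith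
    have "r - t\<^sup>2 < norm w"
    proof (rule ccontr)
      assume "\<not> ?thesis"
      then have "(1 / (r - t\<^sup>2)) *\<^sub>R w \<in> cball 0 1" using rt by (simp add: field_simps)
      moreover have "y = t *\<^sub>R c + (r - t\<^sup>2) *\<^sub>R ((mat 1 + t *\<^sub>R M) *v ((1 / (r - t\<^sup>2)) *\<^sub>R w))"
        using w rt by (simp add: matrix_vector_mult_scaleR algebra_simps)
      ultimately show False using out by blast
    qed
    moreover have "norm w \<le> 2 * (r + norm c)"
    proof -
      have "w = y - t *\<^sub>R c - t *\<^sub>R (M *v w)" using yw by (simp add: algebra_simps)
      then have "norm w = norm (y - t *\<^sub>R c - t *\<^sub>R (M *v w))" by (rule arg_cong)
      then have "norm w \<le> norm y + norm (t *\<^sub>R c) + norm (t *\<^sub>R (M *v w))"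
        using norm_triangle_ineq4[of "y - t *\<^sub>R c" "t *\<^sub>R (M *v w)"]
          norm_triangle_ineq4[of y "t *\<^sub>R c"] by linarith
      moreover have "norm (t *\<^sub>R c) \<le> norm c" using t(1) td d(2) by (simp add: mult_left_le_one_le)
      moreover have "norm y \<le> r" using y K_in_ball by auto
      ultimately show ?thesis using contraction[of w] by simp
    qed
    moreover have "d / real (Suc k) \<le> 1 / real (Suc k)" using d(2) by (intro divide_right_mono) auto
    then have "t < 1 / real (Suc k)" using t(2) by linarith
    ultimately show ?thesis using t(1) td d(2) y yw by (intro exI[of _ t] exI[of _ w]) auto
  qed
  then obtain t w where t: "\<And>k. 0 < t k" "\<And>k. t k < 1 / real (Suc k)" "\<And>k. t k \<le> 1"
    and w: "\<And>k. w k \<in> cball 0 (2 * (r + norm c))"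
    and wr: "\<And>k. r - (t k)\<^sup>2 < norm (w k)"
    and wK: "\<And>k. w k + t k *\<^sub>R (M *v w k + c) \<in> K"
    by metis
  obtain w0 s where s: "strict_mono s" and wlim0: "(w \<circ> s) \<longlonglongrightarrow> w0"
    using w compact_cball[of "0::real^'n" "2 * (r + norm c)"] unfolding compact_def by meson
  have wlim: "(\<lambda>k. w (s k)) \<longlonglongrightarrow> w0" using wlim0 by (simp add: o_def)
  have "t \<longlonglongrightarrow> 0"
    by (rule tendsto_sandwich[OF _ _ tendsto_const LIMSEQ_inverse_real_of_nat])
       (use t in \<open>auto intro!: always_eventually less_imp_le simp: inverse_eq_divide\<close>)
  then have tlim: "(\<lambda>k. t (s k)) \<longlonglongrightarrow> 0"
    using s by (simp add: LIMSEQ_subseq_LIMSEQ[unfolded o_def])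
  have Mlim: "(\<lambda>k. M *v w (s k) + c) \<longlonglongrightarrow> M *v w0 + c"
    using wlim unfolding matrix_vector_mult_def by (intro tendsto_intros)
  have "(\<lambda>k. w (s k) + t (s k) *\<^sub>R (M *v w (s k) + c)) \<longlonglongrightarrow> w0 + 0 *\<^sub>R (M *v w0 + c)"
    by (intro tendsto_intros wlim tlim Mlim)
  from closed_sequentially[OF compact_imp_closed[OF compact_K] _ this]
  have "w0 + 0 *\<^sub>R (M *v w0 + c) \<in> K" using wK by blast
  then have w0K: "w0 \<in> K" by simp
  have "r - 0\<^sup>2 \<le> norm w0"
    by (rule LIMSEQ_le[OF tendsto_diff[OF tendsto_const tendsto_power[OF tlim]] tendsto_norm[OF wlim]])
       (use wr in \<open>auto intro: less_imp_le\<close>)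
  moreover have "norm w0 \<le> r" using w0K K_in_ball by auto
  ultimately have nw: "norm w0 = r" by simp
  define z where "z = (1 / r) *\<^sub>R w0"
  have w0z: "w0 = r *\<^sub>R z" using r_ge_1 by (simp add: z_def)
  have "z \<in> outer_contacts" using w0K nw r_ge_1 by (simp add: outer_contacts_def z_def)
  then have "0 < r\<^sup>2 * (M \<bullet> outer_sq z + (1 / r) * (c \<bullet> z))" using pos r_ge_1 by simp
  also have "\<dots> = w0 \<bullet> (M *v w0 + c)"
    using r_ge_1 by (simp add: w0z inner_outer_sq inner_add_right matrix_vector_mult_scaleR
        inner_commute power2_eq_square algebra_simps)
  finally have "0 < w0 \<bullet> (M *v w0 + c)" .
  moreover have "w0 \<bullet> (M *v w0 + c) \<le> r * 0"
  proof (rule LIMSEQ_le[OF tendsto_inner[OF wlim Mlim] tendsto_mult[OF tendsto_const tlim]],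
      intro exI allI impI)
    fix k
    let ?t = "t (s k)" and ?w = "w (s k)"
    let ?q = "M *v ?w + c"
    have "norm (?w + ?t *\<^sub>R ?q) \<le> r" using wK[of "s k"] K_in_ball by auto
    then have "(norm (?w + ?t *\<^sub>R ?q))\<^sup>2 \<le> r\<^sup>2" by (simp add: power_mono)
    moreover have "(norm (?w + ?t *\<^sub>R ?q))\<^sup>2 = (norm ?w)\<^sup>2 + 2 * ?t * (?w \<bullet> ?q) + (norm (?t *\<^sub>R ?q))\<^sup>2"
      by (simp only: power2_norm_eq_inner inner_add_left inner_add_right inner_scaleR_left
          inner_scaleR_right) (simp add: inner_commute algebra_simps)
    moreover have "?t\<^sup>2 \<le> 1" using t(1,3)[of "s k"] by (intro power_le_one) auto
    then have "0 \<le> r - ?t\<^sup>2" using r_ge_1 by linarith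
    then have "(r - ?t\<^sup>2)\<^sup>2 \<le> (norm ?w)\<^sup>2" using wr[of "s k"] by (intro power_mono) auto
    moreover have "(r - ?t\<^sup>2)\<^sup>2 = r\<^sup>2 - 2 * r * ?t\<^sup>2 + (?t\<^sup>2)\<^sup>2" by (simp add: power2_diff)
    moreover have "0 \<le> (?t\<^sup>2)\<^sup>2" "0 \<le> (norm (?t *\<^sub>R ?q))\<^sup>2" by simp_all
    ultimately have "2 * ?t * (?w \<bullet> ?q) \<le> 2 * r * ?t\<^sup>2" by linarith
    then have "?t * (?w \<bullet> ?q) \<le> ?t * (r * ?t)" by (simp add: power2_eq_square mult_ac)
    then show "?w \<bullet> ?q \<le> r * ?t" using t(1)[of "s k"] by (simp only: mult_le_cancel_left_pos)
  qed
  ultimately show False by simp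
qed

lemma no_improving_perturbation:
  "\<not> ((\<forall>u\<in>inner_contacts. M \<bullet> outer_sq u + c \<bullet> u < 0) \<and>
      (\<forall>z\<in>outer_contacts. M \<bullet> outer_sq z + (1 / r) * (c \<bullet> z) > 0))"
proof
  assume a: "(\<forall>u\<in>inner_contacts. M \<bullet> outer_sq u + c \<bullet> u < 0) \<and>
      (\<forall>z\<in>outer_contacts. M \<bullet> outer_sq z + (1 / r) * (c \<bullet> z) > 0)"
  obtain d1 where d1: "d1 > 0"
    "\<And>t. 0 < t \<Longrightarrow> t < d1 \<Longrightarrow> \<forall>x\<in>cball 0 1. t *\<^sub>R c + (mat 1 + t *\<^sub>R M) *v x \<in> K"
    using inner_perturbation[of M c] a by blast
  obtain d2 where d2: "d2 > 0"
    "\<And>t. 0 < t \<Longrightarrow> t < d2 \<Longrightarrow>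
      \<forall>y\<in>K. \<exists>x\<in>cball 0 1. y = t *\<^sub>R c + (r - t\<^sup>2) *\<^sub>R ((mat 1 + t *\<^sub>R M) *v x)"
    using outer_perturbation[of M c] a by blast
  define t where "t = min (min d1 d2) 1 / 2"
  have t: "0 < t" "t < d1" "t < d2" "t \<le> 1" using d1(1) d2(1) by (auto simp: t_def min_def)
  have "t\<^sup>2 \<le> 1" using t by (simp add: power_le_one)
  then have "0 \<le> r - t\<^sup>2" using r_ge_1 by linarith
  moreover have "ellipsoid_sandwich K (mat 1 + t *\<^sub>R M) (t *\<^sub>R c) (r - t\<^sup>2)"
    unfolding ellipsoid_sandwich_def using d1(2)[OF t(1,2)] d2(2)[OF t(1,3)] by blast
  ultimately have "r \<le> r - t\<^sup>2" by (rule optimal)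
  then show False using t(1) by simp
qed

text \<open>Were the convex hulls of the points \<open>(u u\<^sup>T, u)\<close> and \<open>(z z\<^sup>T, z / r)\<close> disjoint, a separating
  hyperplane would be a pair \<open>(M, c)\<close> excluded by \<open>no_improving_perturbation\<close>. The pair
  \<open>(G, w)\<close> is a common point of the hulls. That it is an average over each family is expressed
  by saying that a lower bound of a test function \<open>x \<mapsto> M \<bullet> outer_sq x + c \<bullet> x\<close> on the
  contacts is also a lower bound of its average; the factor \<open>r\<close> undoes the scaling of \<open>z\<close>.\<close>

lemma contact_moments:
  obtains G w where
    "\<And>M c b. (\<And>u. u \<in> inner_contacts \<Longrightarrow> b \<le> M \<bullet> outer_sq u + c \<bullet> u) \<Longrightarrow> b \<le> M \<bullet> G + c \<bullet> w"
    "\<And>M c b. (\<And>z. z \<in> outer_contacts \<Longrightarrow> b \<le> M \<bullet> outer_sq z + c \<bullet> z) \<Longrightarrow> b \<le> M \<bullet> G + r * (c \<bullet> w)"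
proof -
  define S where "S = convex hull ((\<lambda>u. (outer_sq u, u)) ` inner_contacts)"
  define T where "T = convex hull ((\<lambda>z. (outer_sq z, (1 / r) *\<^sub>R z)) ` outer_contacts)"
  have cS: "compact S" unfolding S_def
    by (intro compact_convex_hull compact_continuous_image compact_inner_contacts
        continuous_intros continuous_on_outer_sq)
  have cT: "compact T" unfolding T_def
    by (intro compact_convex_hull compact_continuous_image compact_outer_contacts
        continuous_intros continuous_on_outer_sq)
  have "S \<inter> T \<noteq> {}"
  proof
    assume disj: "S \<inter> T = {}"
    have one: "mat 1 \<bullet> outer_sq u = 1" if "norm u = 1" for u :: "real^'n"
      using that by (simp add: inner_outer_sq norm_eq_1)
    show False
    proof (cases "inner_contacts = {} \<or> outer_contacts = {}")
      case True
      then show False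
        using no_improving_perturbation[of "mat 1" 0] no_improving_perturbation[of "- mat 1" 0] one
        by (auto simp: inner_contacts_def outer_contacts_def)
    next
      case False
      have "T \<noteq> {}" using False by (simp add: T_def)
      then obtain a b where ab: "\<forall>p\<in>S. a \<bullet> p < b" "\<forall>p\<in>T. a \<bullet> p > b"
        using separating_hyperplane_closed_compact[of S T] cS cT disj
        by (auto simp: S_def T_def compact_imp_closed)
      \<comment> \<open>All \<open>outer_sq u\<close> with \<open>u\<close> of norm 1 have trace 1, so subtracting \<open>b I\<close> moves the separating
        level \<open>b\<close> to \<open>0\<close>.\<close>
      define M c where "M = fst a" and "c = snd a"
      have "(M - b *\<^sub>R mat 1) \<bullet> outer_sq u + c \<bullet> u < 0" if "u \<in> inner_contacts" for u
      proof -
        have "(outer_sq u, u) \<in> S" unfolding S_def using that by (intro hull_inc) auto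
        then have "a \<bullet> (outer_sq u, u) < b" using ab by blast
        then show ?thesis using that one[of u]
          by (simp add: inner_prod_def M_def c_def inner_contacts_def inner_diff_left)
      qed
      moreover have "(M - b *\<^sub>R mat 1) \<bullet> outer_sq z + (1 / r) * (c \<bullet> z) > 0"
        if "z \<in> outer_contacts" for z
      proof -
        have "(outer_sq z, (1 / r) *\<^sub>R z) \<in> T" unfolding T_def using that by (intro hull_inc) auto
        then have "a \<bullet> (outer_sq z, (1 / r) *\<^sub>R z) > b" using ab by blast
        then show ?thesis using that one[of z]
          by (simp add: inner_prod_def M_def c_def outer_contacts_def inner_diff_left)
      qed
      ultimately show False using no_improving_perturbation by blast
    qed
  qed
  then obtain G w where Gw: "(G, w) \<in> S" "(G, w) \<in> T" by auto
  have hull: "b \<le> a \<bullet> p" if "p \<in> convex hull X" "\<And>q. q \<in> X \<Longrightarrow> b \<le> a \<bullet> q"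
    for a p :: "(real^'n^'n) \<times> (real^'n)" and b X
  proof -
    have "convex hull X \<subseteq> {q. a \<bullet> q \<ge> b}"
      using that(2) by (intro hull_minimal convex_halfspace_ge) auto
    then show ?thesis using that(1) by auto
  qed
  show ?thesis
  proof (rule that[of G w])
    show "b \<le> M \<bullet> G + c \<bullet> w"
      if "\<And>u. u \<in> inner_contacts \<Longrightarrow> b \<le> M \<bullet> outer_sq u + c \<bullet> u" for M c b
      using hull[of "(G, w)" _ b "(M, c)"] Gw(1) that unfolding S_def by (fastforce simp: inner_prod_def)
    show "b \<le> M \<bullet> G + r * (c \<bullet> w)"
      if "\<And>z. z \<in> outer_contacts \<Longrightarrow> b \<le> M \<bullet> outer_sq z + c \<bullet> z" for M c b
      using hull[of "(G, w)" _ b "(M, r *\<^sub>R c)"] Gw(2) that r_ge_1 unfolding T_def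
      by (fastforce simp: inner_prod_def)
  qed
qed

end

section \<open>The optimal ratio is at most the dimension\<close>

lemma norm_outer_sq: "norm (outer_sq u) = (norm u)\<^sup>2"
proof -
  have "(norm (outer_sq u))\<^sup>2 = ((norm u)\<^sup>2)\<^sup>2"
    by (simp add: power2_norm_eq_inner outer_sq_inner_outer_sq)
  then show ?thesis by (rule power2_eq_imp_eq) simp_all
qed

lemma mat_1_inner_outer_sq: "mat 1 \<bullet> outer_sq u = (norm u)\<^sup>2"
  by (simp add: inner_outer_sq power2_norm_eq_inner)

lemma mat_1_inner_mat_1: "mat 1 \<bullet> (mat 1 :: real ^ 'n ^ 'n) = real CARD('n)"
proof -
  have "(\<Sum>j\<in>UNIV. (if i = j then 1 else 0) * (if i = j then 1 else 0)) = (1::real)" for i :: 'n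
    by (simp add: if_distrib[of "\<lambda>t. t * _"] cong: if_cong)
  then show ?thesis by (simp add: inner_vec_def mat_def)
qed

context optimal_ball_position
begin

lemma contacts_inner_bounds:
  assumes "u \<in> inner_contacts" "z \<in> outer_contacts"
  shows "-1 \<le> z \<bullet> u" "r * (z \<bullet> u) \<le> 1"
proof -
  have "\<bar>z \<bullet> u\<bar> \<le> norm z * norm u" by (rule Cauchy_Schwarz_ineq2)
  then show "-1 \<le> z \<bullet> u" using assms by (simp add: inner_contacts_def outer_contacts_def)
  show "r * (z \<bullet> u) \<le> 1" using assms by (auto simp: inner_contacts_def outer_contacts_def inner_commute)
qed

lemma contacts_product_nonneg:
  assumes "u \<in> inner_contacts" "z \<in> outer_contacts"
  shows "0 \<le> 1 + (1 - r) * (z \<bullet> u) - r * (z \<bullet> u)\<^sup>2"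
proof -
  have "0 \<le> (1 + z \<bullet> u) * (1 - r * (z \<bullet> u))"
    using contacts_inner_bounds[OF assms] by (intro mult_nonneg_nonneg) auto
  then show ?thesis by (simp add: power2_eq_square algebra_simps)
qed

text \<open>The product \<open>(1 + s) (1 - r s)\<close> with \<open>s = z \<bullet> u\<close> is a test function in each variable
  separately. Averaging it first over \<open>z\<close> and then over \<open>u\<close> preserves its sign.\<close>

lemma contact_moments_bound:
  obtains G w where
    "\<And>M c b. (\<And>u. u \<in> inner_contacts \<Longrightarrow> b \<le> M \<bullet> outer_sq u + c \<bullet> u) \<Longrightarrow> b \<le> M \<bullet> G + c \<bullet> w"
    "\<And>M c b. (\<And>z. z \<in> outer_contacts \<Longrightarrow> b \<le> M \<bullet> outer_sq z + c \<bullet> z) \<Longrightarrow> b \<le> M \<bullet> G + r * (c \<bullet> w)"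
    "mat 1 \<bullet> G = 1"
    "r * (norm G)\<^sup>2 + r * (r - 1) * (norm w)\<^sup>2 \<le> 1"
proof -
  obtain G w where U: "\<And>M c b. (\<And>u. u \<in> inner_contacts \<Longrightarrow> b \<le> M \<bullet> outer_sq u + c \<bullet> u)
      \<Longrightarrow> b \<le> M \<bullet> G + c \<bullet> w"
    and Z: "\<And>M c b. (\<And>z. z \<in> outer_contacts \<Longrightarrow> b \<le> M \<bullet> outer_sq z + c \<bullet> z)
      \<Longrightarrow> b \<le> M \<bullet> G + r * (c \<bullet> w)"
    using contact_moments by metis
  have "1 \<le> mat 1 \<bullet> G + 0 \<bullet> w"
    by (rule U) (simp add: mat_1_inner_outer_sq inner_contacts_def)
  moreover have "-1 \<le> (- mat 1) \<bullet> G + 0 \<bullet> w"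
    by (rule U) (simp add: mat_1_inner_outer_sq inner_contacts_def)
  ultimately have tr: "mat 1 \<bullet> G = 1" by simp
  have g: "-1 \<le> (- r *\<^sub>R G) \<bullet> outer_sq u + (r * (1 - r)) *\<^sub>R w \<bullet> u" if u: "u \<in> inner_contacts" for u
  proof -
    have "-1 \<le> (- r *\<^sub>R outer_sq u) \<bullet> G + r * (((1 - r) *\<^sub>R u) \<bullet> w)"
    proof (rule Z)
      fix z assume "z \<in> outer_contacts"
      from contacts_product_nonneg[OF u this]
      show "-1 \<le> (- r *\<^sub>R outer_sq u) \<bullet> outer_sq z + ((1 - r) *\<^sub>R u) \<bullet> z"
        by (simp add: outer_sq_inner_outer_sq inner_commute)
    qed
    then show ?thesis by (simp add: inner_commute)
  qed
  have "-1 \<le> (- r *\<^sub>R G) \<bullet> G + (r * (1 - r)) *\<^sub>R w \<bullet> w" using g by (rule U)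
  then have "r * (norm G)\<^sup>2 + r * (r - 1) * (norm w)\<^sup>2 \<le> 1"
    by (simp add: power2_norm_eq_inner algebra_simps)
  with U Z tr show ?thesis by (rule that)
qed

lemma ratio_le_dim: "r \<le> real CARD('n)"
proof -
  obtain G :: "real^'n^'n" and w :: "real^'n" where tr: "mat 1 \<bullet> G = 1"
    and b: "r * (norm G)\<^sup>2 + r * (r - 1) * (norm w)\<^sup>2 \<le> 1"
    using contact_moments_bound by metis
  have "(mat 1 \<bullet> G)\<^sup>2 \<le> (mat 1 \<bullet> (mat 1 :: real^'n^'n)) * (G \<bullet> G)" by (rule Cauchy_Schwarz_ineq)
  then have "1 \<le> real CARD('n) * (norm G)\<^sup>2"
    using tr by (simp add: mat_1_inner_mat_1 power2_norm_eq_inner)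
  then have "r * 1 \<le> r * (real CARD('n) * (norm G)\<^sup>2)" using r_ge_1 by (intro mult_left_mono) auto
  also have "\<dots> = real CARD('n) * (r * (norm G)\<^sup>2)" by simp
  also have "\<dots> \<le> real CARD('n) * 1"
  proof (intro mult_left_mono)
    have "0 \<le> r * (r - 1) * (norm w)\<^sup>2" using r_ge_1 by simp
    then show "r * (norm G)\<^sup>2 \<le> 1" using b by linarith
  qed simp
  finally show ?thesis by simp
qed

end


section \<open>Bodies whose optimal ratio is almost the dimension\<close>

text \<open>The defect \<open>\<sigma>\<^sup>2 = 2\<^sup>-\<^sup>2\<^sup>2 n\<^sup>-\<^sup>8\<close> is the one for which \<open>n (n - \<sigma>\<^sup>2)\<close> is the claimed bound. The
  estimates below have errors of order \<open>\<sigma>\<close>, the square root of the defect, and lose a factor of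
  at most a constant times \<open>n\<^sup>4\<close>.\<close>

locale nearly_extremal = optimal_ball_position K r for K :: "(real ^ 'n) set" and r +
  fixes n \<sigma> :: real
  assumes dim_ge_2: "CARD('n) \<ge> 2" and dim: "n = real CARD('n)"
    and sigma: "\<sigma> = 1 / (2048 * n ^ 4)" and ratio_ge: "n - \<sigma>\<^sup>2 \<le> r"
begin

lemma ratio_le_n: "r \<le> n" using ratio_le_dim by (simp add: dim)

lemma n_ge_2: "n \<ge> 2" using dim_ge_2 by (simp add: dim)

lemma sigma_pos: "0 < \<sigma>" using n_ge_2 by (simp add: sigma)

lemma n4_sigma: "n ^ 4 * \<sigma> = 1 / 2048" using n_ge_2 by (simp add: sigma)

lemma n2_sigma: "n\<^sup>2 * \<sigma> \<le> 1 / 8192"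
proof -
  have "2\<^sup>2 * (n\<^sup>2 * \<sigma>) \<le> n\<^sup>2 * (n\<^sup>2 * \<sigma>)"
    using n_ge_2 sigma_pos by (intro mult_right_mono power_mono) auto
  also have "\<dots> = n ^ 4 * \<sigma>" by (simp add: power2_eq_square power4_eq_xxxx)
  finally show ?thesis using n4_sigma by simp
qed

lemma n_sigma: "n * \<sigma> \<le> 1 / 16384"
proof -
  have "2 * (n * \<sigma>) \<le> n * (n * \<sigma>)"
    using n_ge_2 sigma_pos by (intro mult_right_mono) auto
  then show ?thesis using n2_sigma by (simp add: power2_eq_square mult.assoc)
qed

lemma sigma_le: "\<sigma> \<le> 1 / 32768"
proof -
  have "2 * \<sigma> \<le> n * \<sigma>" using n_ge_2 sigma_pos by (intro mult_right_mono) auto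
  then show ?thesis using n_sigma by simp
qed

lemma sigma_sq_le: "\<sigma>\<^sup>2 \<le> \<sigma> / 4"
proof -
  have "\<sigma> * \<sigma> \<le> \<sigma> * (1 / 4)" using sigma_le sigma_pos by (intro mult_left_mono) auto
  then show ?thesis by (simp add: power2_eq_square)
qed

lemma ratio_ge_3_2: "3 / 2 \<le> r"
  using ratio_ge n_ge_2 sigma_sq_le sigma_le by linarith

text \<open>Writing \<open>G = I / n + H\<close>, the bound of \<open>contact_moments_bound\<close> becomes
  \<open>r |H|\<^sup>2 + r (r - 1) |w|\<^sup>2 \<le> 1 - r / n \<le> \<sigma>\<^sup>2 / n\<close>, which makes \<open>H\<close> and \<open>w\<close> of order \<open>\<sigma>\<close>. The
  third and fourth conclusions bound the averages of \<open>(1 + s) (1 - r s)\<close> over the inner and the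
  outer contacts, when the other vector is fixed.\<close>

lemma near_isotropic_moments:
  obtains G w where
    "\<And>M c b. (\<And>u. u \<in> inner_contacts \<Longrightarrow> b \<le> M \<bullet> outer_sq u + c \<bullet> u) \<Longrightarrow> b \<le> M \<bullet> G + c \<bullet> w"
    "\<And>M c b. (\<And>z. z \<in> outer_contacts \<Longrightarrow> b \<le> M \<bullet> outer_sq z + c \<bullet> z) \<Longrightarrow> b \<le> M \<bullet> G + r * (c \<bullet> w)"
    "\<And>v. norm v = 1 \<Longrightarrow> 1 - (r - 1) * (v \<bullet> w) - r * (outer_sq v \<bullet> G) \<le> 2 * \<sigma>"
    "\<And>v. norm v = 1 \<Longrightarrow> 1 - r * (r - 1) * (v \<bullet> w) - r * (outer_sq v \<bullet> G) \<le> 2 * n * \<sigma>"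
    "r * norm w \<le> 2 * \<sigma>"
proof -
  obtain G w where U: "\<And>M c b. (\<And>u. u \<in> inner_contacts \<Longrightarrow> b \<le> M \<bullet> outer_sq u + c \<bullet> u)
      \<Longrightarrow> b \<le> M \<bullet> G + c \<bullet> w"
    and Z: "\<And>M c b. (\<And>z. z \<in> outer_contacts \<Longrightarrow> b \<le> M \<bullet> outer_sq z + c \<bullet> z)
      \<Longrightarrow> b \<le> M \<bullet> G + r * (c \<bullet> w)"
    and tr: "mat 1 \<bullet> G = 1" and bd: "r * (norm G)\<^sup>2 + r * (r - 1) * (norm w)\<^sup>2 \<le> 1"
    using contact_moments_bound by metis
  have n0: "n > 0" using n_ge_2 by simp
  define H where "H = G - (1 / n) *\<^sub>R mat 1"
  define h \<omega> where "h = norm H" and "\<omega> = norm w"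
  have h0: "h \<ge> 0" "\<omega> \<ge> 0" by (simp_all add: h_def \<omega>_def)
  have "h\<^sup>2 = (norm G)\<^sup>2 - 1 / n"
    using tr n0 by (simp add: h_def H_def power2_norm_eq_inner inner_diff inner_commute
        mat_1_inner_mat_1 flip: dim)
  then have "r * h\<^sup>2 + r * (r - 1) * \<omega>\<^sup>2 \<le> 1 - r / n"
    using bd by (simp add: \<omega>_def right_diff_distrib)
  also have gap: "1 - r / n \<le> \<sigma>\<^sup>2 / n"
    using divide_right_mono[of "n - r" "\<sigma>\<^sup>2" n] ratio_ge n0 by (simp add: diff_divide_distrib)
  finally have e: "r * h\<^sup>2 + r * (r - 1) * \<omega>\<^sup>2 \<le> \<sigma>\<^sup>2 / n" .
  have nn: "0 \<le> r * h\<^sup>2" "0 \<le> r * (r - 1) * \<omega>\<^sup>2" using r_ge_1 by simp_all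
  have half: "\<sigma>\<^sup>2 / n \<le> \<sigma>\<^sup>2 / 2" using n_ge_2 by (intro divide_left_mono) auto
  have rh: "r * h \<le> \<sigma>"
  proof (rule power2_le_imp_le)
    have "(r * h)\<^sup>2 = r * (r * h\<^sup>2)" by (simp add: power2_eq_square)
    also have "\<dots> \<le> n * (\<sigma>\<^sup>2 / n)"
      using e nn ratio_le_n r_ge_1 by (intro mult_mono) linarith+
    finally show "(r * h)\<^sup>2 \<le> \<sigma>\<^sup>2" using n0 by simp
  qed (use sigma_pos in simp)
  have r1w: "(r - 1) * \<omega> \<le> 3 / 4 * \<sigma>"
  proof (rule power2_le_imp_le)
    have "((r - 1) * \<omega>)\<^sup>2 = (r - 1) * ((r - 1) * \<omega>\<^sup>2)" by (simp add: power2_eq_square)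
    also have "\<dots> \<le> r * ((r - 1) * \<omega>\<^sup>2)" using r_ge_1 by (intro mult_right_mono) auto
    also have "\<dots> \<le> \<sigma>\<^sup>2 / 2" using e nn half unfolding mult.assoc by linarith
    also have "\<dots> \<le> (3 / 4 * \<sigma>)\<^sup>2" by (simp add: power2_eq_square)
    finally show "((r - 1) * \<omega>)\<^sup>2 \<le> (3 / 4 * \<sigma>)\<^sup>2" .
  qed (use sigma_pos in simp)
  have rw: "r * \<omega> \<le> 2 * \<sigma>"
  proof (rule power2_le_imp_le)
    have "(r * \<omega>)\<^sup>2 = r * (r * \<omega>\<^sup>2)" by (simp add: power2_eq_square)
    also have "\<dots> \<le> r * ((3 * (r - 1)) * \<omega>\<^sup>2)"
      using ratio_ge_3_2 by (intro mult_left_mono mult_right_mono) auto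
    also have "\<dots> = 3 * (r * (r - 1) * \<omega>\<^sup>2)" by simp
    also have "\<dots> \<le> 3 * (\<sigma>\<^sup>2 / 2)" using e nn half by (intro mult_left_mono) linarith+
    also have "\<dots> \<le> (2 * \<sigma>)\<^sup>2" by (simp add: power2_eq_square)
    finally show "(r * \<omega>)\<^sup>2 \<le> (2 * \<sigma>)\<^sup>2" .
  qed (use sigma_pos in simp)
  have quad: "1 - r * (outer_sq v \<bullet> G) \<le> \<sigma>\<^sup>2 / 2 + r * h" if "norm v = 1" for v
  proof -
    have "outer_sq v \<bullet> G = 1 / n + outer_sq v \<bullet> H"
      using that by (simp add: H_def inner_diff_right mat_1_inner_outer_sq
          inner_commute[of "outer_sq v" "mat 1"])
    moreover have "\<bar>outer_sq v \<bullet> H\<bar> \<le> h"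
      using Cauchy_Schwarz_ineq2[of "outer_sq v" H] that by (simp add: norm_outer_sq h_def)
    ultimately have "1 / n - h \<le> outer_sq v \<bullet> G" by linarith
    then have "r * (1 / n - h) \<le> r * (outer_sq v \<bullet> G)" using r_ge_1 by (intro mult_left_mono) auto
    moreover have "r * (1 / n - h) = r / n - r * h" by (simp add: right_diff_distrib)
    ultimately show ?thesis using gap half by linarith
  qed
  have lin: "- (v \<bullet> w) \<le> \<omega>" if "norm v = 1" for v
    using Cauchy_Schwarz_ineq2[of v w] that by (simp add: \<omega>_def)
  show ?thesis
  proof (rule that[OF U Z])
    show "r * norm w \<le> 2 * \<sigma>" using rw by (simp add: \<omega>_def)
  next
    fix v :: "real^'n" assume v: "norm v = 1"
    have l: "- ((r - 1) * (v \<bullet> w)) \<le> (r - 1) * \<omega>"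
      using mult_left_mono[OF lin[OF v], of "r - 1"] r_ge_1 by simp
    then show "1 - (r - 1) * (v \<bullet> w) - r * (outer_sq v \<bullet> G) \<le> 2 * \<sigma>"
      using quad[OF v] rh r1w sigma_sq_le sigma_pos by linarith
    have "- (r * (r - 1) * (v \<bullet> w)) \<le> r * ((r - 1) * \<omega>)"
      using mult_left_mono[OF l, of r] r_ge_1 by (simp add: mult.assoc)
    also have "\<dots> \<le> n * (3 / 4 * \<sigma>)"
      using r1w ratio_le_n r_ge_1 h0 by (intro mult_mono[OF ratio_le_n r1w]) auto
    finally have "- (r * (r - 1) * (v \<bullet> w)) \<le> 3 / 4 * (n * \<sigma>)" by simp
    moreover have "2 * \<sigma> \<le> n * \<sigma>" using n_ge_2 sigma_pos by (intro mult_right_mono) auto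
    ultimately show "1 - r * (r - 1) * (v \<bullet> w) - r * (outer_sq v \<bullet> G) \<le> 2 * n * \<sigma>"
      using quad[OF v] rh sigma_sq_le sigma_pos by linarith
  qed
qed

text \<open>Otherwise \<open>(1 + s - 3 \<sigma>) (1 - r s)\<close> would be non-negative at all inner contacts \<open>u\<close>, while
  its average is at most \<open>2 \<sigma> - 3 \<sigma> (1 - 2 \<sigma>) < 0\<close>.\<close>

lemma antipodal_inner_contact:
  assumes z: "z \<in> outer_contacts"
  obtains u where "u \<in> inner_contacts" "1 + z \<bullet> u \<le> 3 * \<sigma>"
proof -
  obtain G w where U: "\<And>M c b. (\<And>u. u \<in> inner_contacts \<Longrightarrow> b \<le> M \<bullet> outer_sq u + c \<bullet> u)
      \<Longrightarrow> b \<le> M \<bullet> G + c \<bullet> w"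
    and q: "\<And>v. norm v = 1 \<Longrightarrow> 1 - (r - 1) * (v \<bullet> w) - r * (outer_sq v \<bullet> G) \<le> 2 * \<sigma>"
    and rw: "r * norm w \<le> 2 * \<sigma>"
    using near_isotropic_moments by metis
  have nz: "norm z = 1" using z by (simp add: outer_contacts_def)
  have "\<exists>u\<in>inner_contacts. 1 + z \<bullet> u \<le> 3 * \<sigma>"
  proof (rule ccontr)
    assume none: "\<not> ?thesis"
    have "- (1 - 3 * \<sigma>) \<le> (- r *\<^sub>R outer_sq z) \<bullet> G + ((1 - r + 3 * r * \<sigma>) *\<^sub>R z) \<bullet> w"
    proof (rule U)
      fix u assume u: "u \<in> inner_contacts"
      have "0 \<le> (1 + z \<bullet> u - 3 * \<sigma>) * (1 - r * (z \<bullet> u))"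
        using none u contacts_inner_bounds[OF u z] by (intro mult_nonneg_nonneg) auto
      then show "- (1 - 3 * \<sigma>) \<le> (- r *\<^sub>R outer_sq z) \<bullet> outer_sq u + ((1 - r + 3 * r * \<sigma>) *\<^sub>R z) \<bullet> u"
        by (simp add: outer_sq_inner_outer_sq power2_eq_square algebra_simps)
    qed
    moreover have "3 * r * \<sigma> * (z \<bullet> w) \<le> 3 * \<sigma> * (2 * \<sigma>)"
    proof -
      have "r * (z \<bullet> w) \<le> r * norm w"
        using norm_cauchy_schwarz[of z w] nz r_ge_1 by (intro mult_left_mono) auto
      then have "3 * \<sigma> * (r * (z \<bullet> w)) \<le> 3 * \<sigma> * (2 * \<sigma>)"
        using rw sigma_pos by (intro mult_left_mono) auto
      then show ?thesis by (simp add: mult_ac)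
    qed
    moreover have "6 * \<sigma> * \<sigma> < \<sigma>" using sigma_le sigma_pos by simp
    ultimately show False using q[OF nz] by (simp add: algebra_simps)
  qed
  then show ?thesis using that by blast
qed

text \<open>Let \<open>s\<^sub>i = z \<bullet> u i\<close>. The average over \<open>z\<close> of \<open>\<Sum>i\<in>I. 1 - r s\<^sub>i\<close> is about \<open>card I \<le> n\<close>,
  while a single \<open>s\<^sub>i\<close> close to \<open>-1\<close> already contributes about \<open>n + 1\<close>. So some \<open>z\<close> avoids
  this for all \<open>i\<close> at once. Adding \<open>C\<close> times the products \<open>(1 + s\<^sub>i) (1 - r s\<^sub>i)\<close> to the sum
  forces each \<open>s\<^sub>i\<close> to be close to \<open>-1\<close> or to \<open>1 / r\<close>, leaving only \<open>1 / r\<close>.\<close>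

lemma outer_contact_far_from:
  fixes u :: "'i \<Rightarrow> real ^ 'n"
  assumes I: "finite I" "card I \<le> CARD('n)" and u: "\<And>i. i \<in> I \<Longrightarrow> u i \<in> inner_contacts"
  obtains z where "z \<in> outer_contacts" "\<And>i. i \<in> I \<Longrightarrow> 1 - r * (z \<bullet> u i) \<le> 5 / 256"
proof -
  obtain G w where Z: "\<And>M c b. (\<And>z. z \<in> outer_contacts \<Longrightarrow> b \<le> M \<bullet> outer_sq z + c \<bullet> z)
      \<Longrightarrow> b \<le> M \<bullet> G + r * (c \<bullet> w)"
    and q: "\<And>v. norm v = 1 \<Longrightarrow> 1 - r * (r - 1) * (v \<bullet> w) - r * (outer_sq v \<bullet> G) \<le> 2 * n * \<sigma>"
    and rw: "r * norm w \<le> 2 * \<sigma>"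
    using near_isotropic_moments by metis
  \<comment> \<open>The products average to at most \<open>2 n \<sigma>\<close>, so this weight adds at most
    \<open>n C (2 n \<sigma>) = 512 n\<^sup>4 \<sigma> = 1 / 4\<close> to the average of the sum.\<close>
  define C where "C = 256 * n\<^sup>2"
  have C0: "C > 0" using n_ge_2 by (simp add: C_def)
  define f where "f z i = 1 - r * (z \<bullet> u i) + C * (1 + (1 - r) * (z \<bullet> u i) - r * (z \<bullet> u i)\<^sup>2)" for z i
  have "\<exists>z\<in>outer_contacts. (\<Sum>i\<in>I. f z i) \<le> n + 1 / 2"
  proof (rule ccontr)
    assume none: "\<not> ?thesis"
    define M c where "M = (\<Sum>i\<in>I. (- C * r) *\<^sub>R outer_sq (u i))"
      and "c = (\<Sum>i\<in>I. (C * (1 - r) - r) *\<^sub>R u i)"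
    have eval: "(\<Sum>i\<in>I. f z i) = M \<bullet> outer_sq z + c \<bullet> z + real (card I) * (1 + C)" for z
    proof -
      have "M \<bullet> outer_sq z + c \<bullet> z + real (card I) * (1 + C) = (\<Sum>i\<in>I.
          (- C * r) * (u i \<bullet> z)\<^sup>2 + (C * (1 - r) - r) * (u i \<bullet> z) + (1 + C))"
        by (simp add: M_def c_def inner_sum_left outer_sq_inner_outer_sq sum.distrib
            sum_subtractf sum_negf)
      also have "\<dots> = (\<Sum>i\<in>I. f z i)"
        by (intro sum.cong refl) (simp add: f_def inner_commute[of z] algebra_simps)
      finally show ?thesis by simp
    qed
    have "n + 1 / 2 - real (card I) * (1 + C) \<le> M \<bullet> G + r * (c \<bullet> w)"
    proof (rule Z)
      fix z assume "z \<in> outer_contacts"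
      then have "n + 1 / 2 < (\<Sum>i\<in>I. f z i)" using none by auto
      then show "n + 1 / 2 - real (card I) * (1 + C) \<le> M \<bullet> outer_sq z + c \<bullet> z"
        unfolding eval by simp
    qed
    also have "M \<bullet> G + r * (c \<bullet> w)
        = (\<Sum>i\<in>I. C * (- r * (r - 1) * (u i \<bullet> w) - r * (outer_sq (u i) \<bullet> G)) - r * (r * (u i \<bullet> w)))"
      by (simp add: M_def c_def inner_sum_left sum_distrib_left sum.distrib[symmetric] algebra_simps)
    also have "\<dots> \<le> (\<Sum>i\<in>I. C * (2 * n * \<sigma> - 1) + n * (2 * \<sigma>))"
    proof (rule sum_mono)
      fix i assume "i \<in> I"
      then have nu: "norm (u i) = 1" using u by (auto simp: inner_contacts_def)
      have "C * (- r * (r - 1) * (u i \<bullet> w) - r * (outer_sq (u i) \<bullet> G)) \<le> C * (2 * n * \<sigma> - 1)"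
        using q[OF nu] C0 by (intro mult_left_mono) auto
      moreover have "- (u i \<bullet> w) \<le> norm w" using Cauchy_Schwarz_ineq2[of "u i" w] nu by simp
      then have "r * - (u i \<bullet> w) \<le> r * norm w" using r_ge_1 by (intro mult_left_mono) auto
      then have "r * (r * - (u i \<bullet> w)) \<le> r * (2 * \<sigma>)" using rw r_ge_1 by (intro mult_left_mono) auto
      moreover have "r * (2 * \<sigma>) \<le> n * (2 * \<sigma>)"
        using ratio_le_n sigma_pos by (intro mult_right_mono) auto
      ultimately show "C * (- r * (r - 1) * (u i \<bullet> w) - r * (outer_sq (u i) \<bullet> G)) - r * (r * (u i \<bullet> w))
          \<le> C * (2 * n * \<sigma> - 1) + n * (2 * \<sigma>)" by simp
    qed
    finally have "n + 1 / 2 \<le> real (card I) * (1 + C * (2 * n * \<sigma>) + n * (2 * \<sigma>))"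
      by (simp add: algebra_simps)
    also have "\<dots> \<le> n * (1 + C * (2 * n * \<sigma>) + n * (2 * \<sigma>))"
      using I(2) C0 sigma_pos n_ge_2 unfolding dim by (intro mult_right_mono) (auto intro!: add_nonneg_nonneg)
    also have "\<dots> = n + 512 * (n ^ 4 * \<sigma>) + 2 * (n\<^sup>2 * \<sigma>)"
      by (simp add: C_def power2_eq_square power4_eq_xxxx algebra_simps)
    also have "\<dots> < n + 1 / 2" using n4_sigma n2_sigma by simp
    finally show False by simp
  qed
  then obtain z where z: "z \<in> outer_contacts" and sum: "(\<Sum>i\<in>I. f z i) \<le> n + 1 / 2" by blast
  have "1 - r * (z \<bullet> u i) \<le> 5 / 256" if i: "i \<in> I" for i
  proof -
    define g where "g j = 1 + (1 - r) * (z \<bullet> u j) - r * (z \<bullet> u j)\<^sup>2" for j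
    have g0: "0 \<le> g j" if "j \<in> I" for j
      using contacts_product_nonneg[OF u[OF that] z] by (simp add: g_def)
    have f0: "0 \<le> f z j" if "j \<in> I" for j
      using contacts_inner_bounds[OF u[OF that] z] g0[OF that] C0 by (simp add: f_def g_def)
    have "f z i \<le> (\<Sum>i\<in>I. f z i)" using f0 I(1) i by (intro member_le_sum) auto
    then have fi: "1 - r * (z \<bullet> u i) + C * g i \<le> n + 1 / 2" using sum by (simp add: f_def g_def)
    let ?t = "r * (z \<bullet> u i)"
    have "0 \<le> C * g i" using C0 g0[OF i] by simp
    then have "1 - ?t \<le> n + 1 / 2" using fi by linarith
    then have rt: "1 / 4 \<le> r + ?t" using ratio_ge sigma_sq_le sigma_le by linarith
    have t1: "0 \<le> 1 - ?t" using contacts_inner_bounds[OF u[OF i] z] by simp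
    have "C * (1 / 4 * (1 - ?t)) \<le> C * ((r + ?t) * (1 - ?t))"
      using rt t1 C0 by (intro mult_left_mono mult_right_mono) auto
    also have "(r + ?t) * (1 - ?t) = r * g i" by (simp add: g_def power2_eq_square algebra_simps)
    also have "C * (r * g i) = r * (C * g i)" by simp
    also have "\<dots> \<le> n * (n + 1 / 2)"
      using fi t1 ratio_le_n r_ge_1 \<open>0 \<le> C * g i\<close> by (intro mult_mono) linarith+
    also have "\<dots> \<le> 5 / 4 * n\<^sup>2"
    proof -
      have "n * 2 \<le> n * n" using n_ge_2 by (intro mult_left_mono) auto
      then show ?thesis by (simp add: power2_eq_square distrib_left)
    qed
    finally have "n\<^sup>2 * (1 - ?t) \<le> n\<^sup>2 * (5 / 256)" by (simp add: C_def)
    moreover have "n\<^sup>2 > 0" using n_ge_2 by simp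
    ultimately show ?thesis by (simp only: mult_le_cancel_left_pos)
  qed
  with z show ?thesis by (rule that)
qed

lemma greedy_contacts:
  assumes "k \<le> CARD('n) + 1"
  shows "\<exists>z u :: nat \<Rightarrow> real ^ 'n. \<forall>i<k. z i \<in> outer_contacts \<and> u i \<in> inner_contacts \<and>
    1 + z i \<bullet> u i \<le> 3 * \<sigma> \<and> (\<forall>j<i. 1 - r * (z i \<bullet> u j) \<le> 5 / 256)"
  using assms
proof (induction k)
  case (Suc k)
  then obtain z u :: "nat \<Rightarrow> real ^ 'n" where zu: "\<And>i. i < k \<Longrightarrow> z i \<in> outer_contacts \<and>
      u i \<in> inner_contacts \<and> 1 + z i \<bullet> u i \<le> 3 * \<sigma> \<and> (\<forall>j<i. 1 - r * (z i \<bullet> u j) \<le> 5 / 256)"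
    by auto
  obtain z' where z': "z' \<in> outer_contacts" "\<And>i. i < k \<Longrightarrow> 1 - r * (z' \<bullet> u i) \<le> 5 / 256"
    using outer_contact_far_from[of "{..<k}" u] Suc.prems zu by auto
  obtain u' where u': "u' \<in> inner_contacts" "1 + z' \<bullet> u' \<le> 3 * \<sigma>"
    using antipodal_inner_contact[OF z'(1)] by blast
  show ?case
    by (rule exI[of _ "z(k := z')"], rule exI[of _ "u(k := u')"])
       (use zu z' u' in \<open>auto simp: less_Suc_eq\<close>)
qed simp

lemma antipodal_dist:
  assumes "norm z = 1" "norm u = 1" "1 + z \<bullet> u \<le> 3 * \<sigma>"
  shows "r * norm (z + u) \<le> 1 / 32"
proof (rule power2_le_imp_le)
  have "(norm (z + u))\<^sup>2 = 2 * (1 + z \<bullet> u)"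
    using assms(1,2) by (simp add: power2_norm_eq_inner inner_add norm_eq_1 inner_commute)
  then have "(norm (z + u))\<^sup>2 \<le> 6 * \<sigma>" using assms(3) by simp
  then have "r\<^sup>2 * (norm (z + u))\<^sup>2 \<le> n\<^sup>2 * (6 * \<sigma>)"
    using ratio_le_n r_ge_1 by (intro mult_mono power_mono) auto
  also have "\<dots> = 6 * (n\<^sup>2 * \<sigma>)" by simp
  also have "\<dots> \<le> (1 / 32)\<^sup>2" using n2_sigma by (simp add: power2_eq_square)
  finally show "(r * norm (z + u))\<^sup>2 \<le> (1 / 32)\<^sup>2" by (simp add: power_mult_distrib)
qed simp

text \<open>The greedy choice controls \<open>z i \<bullet> u j\<close> only for \<open>j < i\<close>. Since \<open>u i\<close> is close to \<open>- z i\<close>,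
  both \<open>z i \<bullet> u j\<close> and \<open>z j \<bullet> u i\<close> are close to \<open>- (z i \<bullet> z j)\<close>, which gives the
  remaining pairs.\<close>

lemma near_simplex_contacts:
  obtains z u :: "nat \<Rightarrow> real ^ 'n" where
    "\<And>i. i \<le> CARD('n) \<Longrightarrow> z i \<in> outer_contacts"
    "\<And>i. i \<le> CARD('n) \<Longrightarrow> u i \<in> inner_contacts"
    "\<And>i. i \<le> CARD('n) \<Longrightarrow> n + 3 / 4 \<le> 1 - r * (z i \<bullet> u i)"
    "\<And>i j. i \<le> CARD('n) \<Longrightarrow> j \<le> CARD('n) \<Longrightarrow> i \<noteq> j \<Longrightarrow> 1 - r * (z i \<bullet> u j) \<le> 1 / 8"
proof -
  obtain z u :: "nat \<Rightarrow> real ^ 'n" where zu: "\<And>i. i \<le> CARD('n) \<Longrightarrow> z i \<in> outer_contacts \<and>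
      u i \<in> inner_contacts \<and> 1 + z i \<bullet> u i \<le> 3 * \<sigma> \<and> (\<forall>j<i. 1 - r * (z i \<bullet> u j) \<le> 5 / 256)"
    using greedy_contacts[of "CARD('n) + 1"] by (auto simp: less_Suc_eq_le)
  have nzu: "norm (z i) = 1" "norm (u i) = 1" if "i \<le> CARD('n)" for i
    using zu[OF that] by (auto simp: inner_contacts_def outer_contacts_def)
  have d: "r * norm (z i + u i) \<le> 1 / 32" if "i \<le> CARD('n)" for i
    using antipodal_dist nzu that zu by blast
  have diag: "n + 3 / 4 \<le> 1 - r * (z i \<bullet> u i)" if "i \<le> CARD('n)" for i
  proof -
    have "r * (1 + z i \<bullet> u i) \<le> n * (3 * \<sigma>)"
      using zu[OF that] contacts_inner_bounds[of "u i" "z i"] ratio_le_n r_ge_1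
      by (intro mult_mono) auto
    then show ?thesis using n_sigma ratio_ge sigma_sq_le sigma_le by (simp add: distrib_left)
  qed
  have sym: "1 - r * (z i \<bullet> u j) \<le> 1 / 8" if ij: "i \<le> CARD('n)" "j \<le> CARD('n)" "i < j" for i j
  proof -
    have "z i \<bullet> (z j + u j) \<ge> - norm (z j + u j)" "z j \<bullet> (z i + u i) \<le> norm (z i + u i)"
      using Cauchy_Schwarz_ineq2[of "z i" "z j + u j"] Cauchy_Schwarz_ineq2[of "z j" "z i + u i"] nzu ij
      by simp_all
    then have "z j \<bullet> u i - norm (z i + u i) - norm (z j + u j) \<le> z i \<bullet> u j"
      by (simp add: inner_add_right inner_commute)
    then have "r * (z j \<bullet> u i - norm (z i + u i) - norm (z j + u j)) \<le> r * (z i \<bullet> u j)"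
      using r_ge_1 by (intro mult_left_mono) auto
    moreover have "1 - r * (z j \<bullet> u i) \<le> 5 / 256" using zu ij by blast
    ultimately show ?thesis using d[OF ij(1)] d[OF ij(2)] by (simp add: right_diff_distrib)
  qed
  show ?thesis
  proof (rule that[OF _ _ diag])
    show "1 - r * (z i \<bullet> u j) \<le> 1 / 8" if "i \<le> CARD('n)" "j \<le> CARD('n)" "i \<noteq> j" for i j
    proof (cases "i < j")
      case False
      then have "1 - r * (z i \<bullet> u j) \<le> 5 / 256" using zu that by auto
      then show ?thesis by simp
    qed (use sym that in blast)
  qed (use zu in auto)
qed

end

section \<open>Bodies between two nearly equal simplices\<close>

text \<open>In the application \<open>\<beta>\<close> are the barycentric coordinates of a point with respect to points
  \<open>p j\<close>, and \<open>a i j\<close> is the slack of \<open>p j\<close> in the \<open>i\<close>-th half-space. The diagonal of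
  this matrix dominates, so a very negative \<open>\<beta> i\<close> would make the slack of the point itself
  negative in the \<open>i\<close>-th half-space.\<close>

lemma barycentric_lower_bound:
  fixes a :: "'i :: finite \<Rightarrow> 'i \<Rightarrow> real" and \<beta> :: "'i \<Rightarrow> real"
  assumes diag: "\<And>i. real CARD('i) - 1 / 4 \<le> a i i"
    and off: "\<And>i j. i \<noteq> j \<Longrightarrow> 0 \<le> a i j \<and> a i j \<le> 1 / 8"
    and card: "CARD('i) \<ge> 2"
    and sum: "(\<Sum>j\<in>UNIV. \<beta> j) = 1"
    and nonneg: "\<And>i. 0 \<le> (\<Sum>j\<in>UNIV. \<beta> j * a i j)"
  shows "- 1 / (4 * real CARD('i)) \<le> \<beta> i"
proof -
  define N where "N = real CARD('i)"
  have N: "N \<ge> 2" using card by (simp add: N_def)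
  define i0 where "i0 = arg_min_on \<beta> UNIV"
  have i0: "\<beta> i0 \<le> \<beta> j" for j
    unfolding i0_def using arg_min_least[of UNIV j \<beta>] by simp
  define m where "m = max 0 (- \<beta> i0)"
  have m: "m \<ge> 0" "- m \<le> \<beta> j" for j using i0[of j] by (auto simp: m_def)
  have "m \<le> 1 / (4 * N)"
  proof (cases "\<beta> i0 < 0")
    case True
    then have mi: "\<beta> i0 = - m" by (simp add: m_def)
    have "(\<Sum>j\<in>UNIV - {i0}. \<beta> j * a i0 j) \<le> (\<Sum>j\<in>UNIV - {i0}. (\<beta> j + m) * (1 / 8))"
    proof (rule sum_mono)
      fix j assume "j \<in> UNIV - {i0}"
      then have o: "0 \<le> a i0 j" "a i0 j \<le> 1 / 8" using off[of i0 j] by auto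
      have "\<beta> j * a i0 j \<le> (\<beta> j + m) * a i0 j" using o m by (intro mult_right_mono) auto
      also have "\<dots> \<le> (\<beta> j + m) * (1 / 8)" using o m(2)[of j] by (intro mult_left_mono) auto
      finally show "\<beta> j * a i0 j \<le> (\<beta> j + m) * (1 / 8)" .
    qed
    also have "\<dots> \<le> (\<Sum>j\<in>UNIV. (\<beta> j + m) * (1 / 8))"
    proof (rule sum_mono2)
      have "0 \<le> \<beta> j + m" for j using m(2)[of j] by linarith
      then show "0 \<le> (\<beta> j + m) * (1 / 8)" for j by simp
    qed auto
    also have "\<dots> = (1 + N * m) / 8"
      using sum by (simp add: sum_distrib_right[symmetric] sum_divide_distrib[symmetric] sum.distrib N_def)
    finally have "(\<Sum>j\<in>UNIV - {i0}. \<beta> j * a i0 j) \<le> (1 + N * m) / 8" .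
    moreover have "(\<Sum>j\<in>UNIV. \<beta> j * a i0 j) = \<beta> i0 * a i0 i0 + (\<Sum>j\<in>UNIV - {i0}. \<beta> j * a i0 j)"
      by (rule sum.remove) auto
    ultimately have "m * a i0 i0 \<le> (1 + N * m) / 8" using nonneg[of i0] mi by simp
    moreover have "m * (N - 1 / 4) \<le> m * a i0 i0"
      using diag[of i0] m(1) by (intro mult_left_mono) (auto simp: N_def)
    ultimately have "7 * (N * m) - 2 * m \<le> 1" by (simp add: algebra_simps)
    moreover have "2 * m \<le> N * m" using N m(1) by (intro mult_right_mono) auto
    ultimately have "4 * (N * m) \<le> 1" using m(1) by linarith
    then show ?thesis using N by (simp add: field_simps)
  qed (use N in \<open>simp add: m_def\<close>)
  then show ?thesis using m(2)[of i] by (simp add: N_def)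
qed

definition standard_simplex :: "(real ^ 'n) set" where
  "standard_simplex = {y. (\<forall>i. 0 \<le> y $ i) \<and> (\<Sum>i\<in>UNIV. y $ i) \<le> 1}"

lemma sum_option: "(\<Sum>j\<in>UNIV. f j) = f None + (\<Sum>i\<in>UNIV. f (Some i))"
  for f :: "'n :: finite option \<Rightarrow> 'a :: comm_monoid_add"
  by (simp add: UNIV_option_conv sum.reindex)

text \<open>All barycentric coordinates of points of \<open>K\<close> are at least \<open>-1 / (4 N)\<close>, where \<open>N\<close> is the
  number of vertices. Increasing every coordinate by this amount raises their sum from \<open>1\<close> to
  \<open>5 / 4\<close>.\<close>

lemma bm_le_standard_simplex:
  fixes K :: "(real ^ 'n) set" and p u :: "'n option \<Rightarrow> real ^ 'n"
  assumes convK: "convex K" and pK: "\<And>i. p i \<in> K" and uK: "\<And>i x. x \<in> K \<Longrightarrow> u i \<bullet> x \<le> 1"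
    and diag: "\<And>i. real CARD('n) + 3 / 4 \<le> 1 - u i \<bullet> p i"
    and off: "\<And>i j. i \<noteq> j \<Longrightarrow> 1 - u i \<bullet> p j \<le> 1 / 8"
  shows "bm_le K standard_simplex (5 / 4)"
proof -
  define N where "N = real CARD('n) + 1"
  have cardN: "real CARD('n option) = N" by (simp add: N_def card_UNIV_option)
  have N: "N \<ge> 2" unfolding N_def using zero_less_card_finite[where 'a = 'n] by linarith
  define T where "T y = (\<Sum>i\<in>UNIV. y $ i *\<^sub>R (p (Some i) - p None))" for y :: "real ^ 'n"
  define \<beta> where "\<beta> y j = (case j of None \<Rightarrow> 1 - (\<Sum>i\<in>UNIV. y $ i) | Some i \<Rightarrow> y $ i)"
    for y :: "real ^ 'n" and j
  have T: "linear T"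
    by (intro linearI) (simp_all add: T_def algebra_simps sum.distrib scaleR_sum_right sum_subtractf)
  have sum\<beta>: "(\<Sum>j\<in>UNIV. \<beta> y j) = 1" for y by (simp add: \<beta>_def sum_option)
  have comb: "p None + T y = (\<Sum>j\<in>UNIV. \<beta> y j *\<^sub>R p j)" for y
    by (simp add: T_def \<beta>_def sum_option algebra_simps scaleR_sum_left sum_subtractf)
  have lower: "- 1 / (4 * N) \<le> \<beta> y j" if "p None + T y \<in> K" for y j
  proof -
    have "- 1 / (4 * real CARD('n option)) \<le> \<beta> y j"
    proof (rule barycentric_lower_bound[where a = "\<lambda>i j. 1 - u i \<bullet> p j"])
      show "real CARD('n option) - 1 / 4 \<le> 1 - u i \<bullet> p i" for i
        using diag[of i] by (simp add: card_UNIV_option)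
      show "0 \<le> 1 - u i \<bullet> p j \<and> 1 - u i \<bullet> p j \<le> 1 / 8" if "i \<noteq> j" for i j
        using off[OF that] uK[OF pK[of j], of i] by simp
      show "CARD('n option) \<ge> 2" using zero_less_card_finite[where 'a = 'n] by (simp add: card_UNIV_option)
      show "(\<Sum>j\<in>UNIV. \<beta> y j) = 1" by (rule sum\<beta>)
      show "0 \<le> (\<Sum>j\<in>UNIV. \<beta> y j * (1 - u i \<bullet> p j))" for i
      proof -
        have "(\<Sum>j\<in>UNIV. \<beta> y j * (1 - u i \<bullet> p j)) = (\<Sum>j\<in>UNIV. \<beta> y j) - u i \<bullet> (\<Sum>j\<in>UNIV. \<beta> y j *\<^sub>R p j)"
          by (simp add: inner_sum_right right_diff_distrib sum_subtractf)
        also have "\<dots> = 1 - u i \<bullet> (p None + T y)" by (simp add: sum\<beta> comb)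
        finally show ?thesis using uK[OF that, of i] by simp
      qed
    qed
    then show ?thesis by (simp only: cardN)
  qed
  \<comment> \<open>A kernel vector could be added to the coordinates of the vertex \<open>p None\<close> with any factor,
    contradicting the lower bound.\<close>
  have "inj T"
    unfolding linear_injective_0[OF T]
  proof (intro allI impI)
    fix y assume y: "T y = 0"
    have "y $ i = 0" for i
    proof (rule ccontr)
      assume yi: "y $ i \<noteq> 0"
      define s where "s = - 1 / y $ i"
      have "p None + T (s *\<^sub>R y) \<in> K" using y pK by (simp add: linear_scale[OF T])
      from lower[OF this, of "Some i"] have "- 1 / (4 * N) \<le> s * y $ i" by (simp add: \<beta>_def)
      also have "\<dots> = - 1" using yi by (simp add: s_def)
      finally show False using N by (simp add: field_simps)
    qed
    then show "y = 0" by (simp add: vec_eq_iff)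
  qed
  then have bT: "bij T" using linear_injective_imp_surjective[OF T] by (simp add: bij_def)
  define e :: "real ^ 'n" where "e = (\<chi> i. 1 / (4 * N))"
  show ?thesis
  proof (rule bm_leI)
    show "linear (\<lambda>y. (5 / 4) *\<^sub>R T y)" using T by (rule linear_compose_scale_right)
    have "bij (\<lambda>x :: real^'n. (5 / 4) *\<^sub>R x)"
      by (intro o_bij[of "\<lambda>x. (4 / 5) *\<^sub>R x"]) (auto simp: fun_eq_iff)
    then have "bij ((\<lambda>x. (5 / 4) *\<^sub>R x) \<circ> T)" using bT by (rule bij_comp[rotated])
    then show "bij (\<lambda>y. (5 / 4) *\<^sub>R T y)" by (simp add: o_def)
    show "\<exists>y\<in>standard_simplex. x = (p None - T e) + (5 / 4) *\<^sub>R T y" if x: "x \<in> K" for x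
    proof -
      obtain y where y: "x - p None = T y" using bT by (meson bij_is_surj surjD)
      have K: "p None + T y \<in> K" using x y by (simp add: algebra_simps)
      define y' where "y' = (4 / 5) *\<^sub>R (y + e)"
      have "0 \<le> y' $ i" for i using lower[OF K, of "Some i"] by (simp add: y'_def e_def \<beta>_def)
      moreover have "(\<Sum>i\<in>UNIV. y' $ i) \<le> 1"
      proof -
        have "(\<Sum>i\<in>UNIV. y $ i) \<le> 1 + 1 / (4 * N)" using lower[OF K, of None] by (simp add: \<beta>_def)
        moreover have "(\<Sum>i\<in>UNIV. e $ i) = 1 / 4 - 1 / (4 * N)"
          using N by (simp add: e_def N_def field_simps)
        ultimately have "(\<Sum>i\<in>UNIV. y $ i) + (\<Sum>i\<in>UNIV. e $ i) \<le> 5 / 4" by linarith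
        moreover have "(\<Sum>i\<in>UNIV. y' $ i) = 4 / 5 * ((\<Sum>i\<in>UNIV. y $ i) + (\<Sum>i\<in>UNIV. e $ i))"
          by (simp add: y'_def sum_distrib_left distrib_left sum.distrib)
        ultimately show ?thesis by simp
      qed
      ultimately have "y' \<in> standard_simplex" by (simp add: standard_simplex_def)
      moreover have "x = (p None - T e) + (5 / 4) *\<^sub>R T y'"
        using y by (simp add: y'_def linear_scale[OF T] linear_add[OF T] algebra_simps)
      ultimately show ?thesis by blast
    qed
    show "\<exists>x\<in>K. (5 / 4) *\<^sub>R T y = - (5 / 4) *\<^sub>R p None + (5 / 4) *\<^sub>R x" if "y \<in> standard_simplex" for y
    proof (rule bexI)
      show "(5 / 4) *\<^sub>R T y = - (5 / 4) *\<^sub>R p None + (5 / 4) *\<^sub>R (p None + T y)"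
        by (simp add: scaleR_add_right)
      have "0 \<le> \<beta> y j" for j
        using that by (cases j) (auto simp: standard_simplex_def \<beta>_def)
      then show "p None + T y \<in> K"
        unfolding comb using pK sum\<beta> by (intro convex_sum[OF _ convK]) auto
    qed
  qed simp
qed

lemma (in nearly_extremal) bm_le_simplex: "bm_le K standard_simplex (5 / 4)"
proof -
  obtain z u :: "nat \<Rightarrow> real ^ 'n" where
    z: "\<And>i. i \<le> CARD('n) \<Longrightarrow> z i \<in> outer_contacts"
    and u: "\<And>i. i \<le> CARD('n) \<Longrightarrow> u i \<in> inner_contacts"
    and diag: "\<And>i. i \<le> CARD('n) \<Longrightarrow> n + 3 / 4 \<le> 1 - r * (z i \<bullet> u i)"
    and off: "\<And>i j. i \<le> CARD('n) \<Longrightarrow> j \<le> CARD('n) \<Longrightarrow> i \<noteq> j \<Longrightarrow> 1 - r * (z i \<bullet> u j) \<le> 1 / 8"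
    using near_simplex_contacts by metis
  obtain h :: "'n option \<Rightarrow> nat" where h: "bij_betw h UNIV {0..<CARD('n option)}"
    using ex_bij_betw_finite_nat[OF finite] by blast
  have hle: "h i \<le> CARD('n)" for i
    using bij_betwE[OF h] by (auto simp: card_UNIV_option less_Suc_eq_le)
  have hne: "h i \<noteq> h j" if "i \<noteq> j" for i j
    using bij_betw_imp_inj_on[OF h] that by (auto simp: inj_on_def)
  show ?thesis
  proof (rule bm_le_standard_simplex[where p = "\<lambda>i. r *\<^sub>R z (h i)" and u = "\<lambda>i. u (h i)"])
    show "convex K" by (rule convex_K)
    show "r *\<^sub>R z (h i) \<in> K" for i using z[OF hle] by (simp add: outer_contacts_def)
    show "u (h i) \<bullet> x \<le> 1" if "x \<in> K" for i x using u[OF hle] that by (simp add: inner_contacts_def)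
    show "real CARD('n) + 3 / 4 \<le> 1 - u (h i) \<bullet> (r *\<^sub>R z (h i))" for i
      using diag[OF hle, of i] by (simp add: dim inner_commute)
    show "1 - u (h i) \<bullet> (r *\<^sub>R z (h j)) \<le> 1 / 8" if "i \<noteq> j" for i j
      using off[OF hle hle, of j i] hne[of j i] that by (simp add: inner_commute)
  qed
qed

section \<open>The distance bound\<close>

theorem corollary8:
  fixes K L :: "(real ^ 'n) set"
  assumes "CARD('n) \<ge> 2"
    and "convex_body K" and "convex_body L"
  shows "banach_mazur_dist K L
    < real CARD('n) ^ 2 - 2 powi (-22) * real CARD('n) powi (-7)"
proof -
  define n \<sigma> where "n = real CARD('n)" and "\<sigma> = 1 / (2048 * n ^ 4)"
  have n: "n \<ge> 2" using assms(1) by (simp add: n_def)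
  have bound: "n ^ 2 - 2 powi (-22) * n powi (-7) = n * (n - \<sigma>\<^sup>2)"
    using n by (simp add: \<sigma>_def power_int_minus field_simps power2_eq_square
        eval_nat_numeral power_int_def)
  have s1: "\<sigma>\<^sup>2 \<le> 1 / 4"
  proof -
    have "1 \<le> n ^ 4" using n by simp
    then have "\<sigma> \<le> 1 / 2048" unfolding \<sigma>_def by (intro frac_le) auto
    moreover have "0 \<le> \<sigma>" using n by (simp add: \<sigma>_def)
    ultimately have "\<sigma>\<^sup>2 \<le> (1 / 2048)\<^sup>2" by (rule power_mono)
    then show ?thesis by (simp add: power2_eq_square)
  qed
  have big: "25 / 16 < n * (n - \<sigma>\<^sup>2)"
  proof -
    have "2 * (7 / 4) \<le> n * (n - \<sigma>\<^sup>2)" using n s1 by (intro mult_mono) auto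
    then show ?thesis by simp
  qed
  have K: "convex K" "K \<noteq> {}" using assms(2) by (auto simp: convex_body_def)
  obtain K' r where K': "optimal_ball_position K' r" "bm_le K K' 1"
    using optimal_ball_position_exists[OF assms(2)] by blast
  obtain L' s where L': "optimal_ball_position L' s" "bm_le L L' 1"
    using optimal_ball_position_exists[OF assms(3)] by blast
  have KB: "bm_le K (cball 0 1) r"
    using bm_le_trans[OF K'(2) optimal_ball_position.bm_le_ball[OF K'(1)]] by simp
  have LB: "bm_le L (cball 0 1) s"
    using bm_le_trans[OF L'(2) optimal_ball_position.bm_le_ball[OF L'(1)]] by simp
  have rs: "1 \<le> r" "r \<le> n" "1 \<le> s" "s \<le> n"
    using optimal_ball_position.r_ge_1 optimal_ball_position.ratio_le_dim K'(1) L'(1)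
    by (auto simp: n_def)
  have "\<exists>t. t < n * (n - \<sigma>\<^sup>2) \<and> bm_le K L t"
  proof (cases "r < n - \<sigma>\<^sup>2 \<or> s < n - \<sigma>\<^sup>2")
    case True
    have "r * s < n * (n - \<sigma>\<^sup>2)"
    proof (cases "r < n - \<sigma>\<^sup>2")
      case r: True
      have "r * s \<le> r * n" using rs by (intro mult_left_mono) auto
      also have "\<dots> < (n - \<sigma>\<^sup>2) * n" using r n by (intro mult_strict_right_mono) auto
      finally show ?thesis by (simp add: mult.commute)
    next
      case False
      then have s: "s < n - \<sigma>\<^sup>2" using True by blast
      have "r * s \<le> n * s" using rs by (intro mult_right_mono) auto
      also have "\<dots> < n * (n - \<sigma>\<^sup>2)" using s n by (intro mult_strict_left_mono) auto
      finally show ?thesis .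
    qed
    moreover have "bm_le K L (r * s)" by (rule bm_le_trans[OF KB bm_le_sym[OF LB]])
    ultimately show ?thesis by blast
  next
    case False
    have "nearly_extremal K' r n \<sigma>" "nearly_extremal L' s n \<sigma>"
      using K'(1) L'(1) False assms(1)
      by (auto simp: nearly_extremal_def nearly_extremal_axioms_def n_def \<sigma>_def)
    then have "bm_le K' standard_simplex (5 / 4)" "bm_le L' standard_simplex (5 / 4)"
      by (auto intro: nearly_extremal.bm_le_simplex)
    then have "bm_le K standard_simplex (5 / 4)" "bm_le L standard_simplex (5 / 4)"
      using bm_le_trans[OF K'(2)] bm_le_trans[OF L'(2)] by fastforce+
    then have "bm_le K L (5 / 4 * (5 / 4))" using bm_le_trans bm_le_sym by blast
    then have "bm_le K L (25 / 16)" by simp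
    then show ?thesis using big by blast
  qed
  then obtain t where t: "t < n * (n - \<sigma>\<^sup>2)" "bm_le K L t" by blast
  define t' where "t' = max t (25 / 16)"
  have "bm_le K L t'" using bm_le_mono[OF t(2) _ K] by (simp add: t'_def)
  then have "banach_mazur_dist K L \<le> t'" by (rule banach_mazur_dist_le) (simp add: t'_def)
  also have "t' < n * (n - \<sigma>\<^sup>2)" using t(1) big by (simp add: t'_def)
  finally show ?thesis using bound by (simp add: n_def)
qed

end
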